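(* Let $X$ be a Polish space, $h:X\to\mathbb R$, and let $\kappa$ be a nonzero countable ordinal with $\kappa\sim(\xi,\alpha)$. Then $h\in\mathcal M(\kappa,\kappa)$ if and only if $\bigcap_{M>0}h_M^{\omega^\kappa}(X)=\emptyset$ and $\Omega^{\omega^\alpha}_{h,\xi}(X)=\emptyset$.
   Context: Oscillation rank: for $f:X\to\mathbb R$, $\varepsilon>0$ and closed $F$, $D^0(f,\varepsilon,F)=F$, $D^1(f,\varepsilon,F)$ = set of $x\in F$ such that every neighbourhood $U$ of $x$ contains $x_1,x_2\in F\cap U$ with $|f(x_1)-f(x_2)|\ge\varepsilon$, iterated transfinitely with intersections at limits; $\beta(f)=\sup_{\varepsilon>0}\beta(f,\varepsilon)$ where $\beta(f,\varepsilon)$ is the least $\alpha$ with $D^\alpha(f,\varepsilon,X)=\emptyset$ ($\omega_1$ if none). $\mathfrak B_1^\lambda(X)=\{f\in\mathfrak B_1(X):\beta(f)\le\omega^\lambda\}$ for countable $\lambda$. $\mathcal M(\kappa,\lambda)$ is the set of $h:X\to\mathbb R$ such that $hf\in\mathfrak B_1^\lambda(X)$ whenever $f\in\mathfrak B_1^\kappa(X)$. A derivation is a map $\delta$ from closed sets to closed sets with $\delta(P)\subseteq P$; iterates: $\delta^0(P)=P$, $\delta^{\alpha+1}(P)=\delta(\delta^\alpha(P))$, $\delta^\alpha(P)=\bigcap_{\alpha'<\alpha}\delta^{\alpha'}(P)$ for limit $\alpha$. $A'$ denotes the set of accumulation points of $A$ in $X$. For $M\ge0$, $h_M(P)=(P\cap\{|h|>M\})'$.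 For closed $P$ and $\varepsilon>0$, $O(h,\varepsilon,P)$ is the set of $x\in P$ such that every neighbourhood $U$ of $x$ contains $y\in U\cap P$ with $|h(y)-h(x)|\ge\varepsilon$, and $\delta(h,\varepsilon,P)=\overline{O(h,\varepsilon,P)}$. For each countable ordinal $\xi$ a sequence $(\xi_n)$ of ordinals strictly increasing to $\omega^{\omega^\xi}$ is fixed, and $\Omega_{h,\xi}(P)=\bigcap_n\big[\bigcup_{\eta>0}\delta^{\xi_n}(h,\eta,P)\big]'$. For nonzero countable $\kappa$ with Cantor normal form $\kappa=\omega^{\kappa_1}m_1+\dots+\omega^{\kappa_k}m_k$ ($\kappa_1>\dots>\kappa_k$, $m_i\in\mathbb N$), write $\kappa\sim(\xi,\alpha)$ where $\xi=\kappa_1$ and $\alpha=\omega^{\kappa_1}(m_1-1)+\omega^{\kappa_2}m_2+\dots+\omega^{\kappa_k}m_k$ (so $\kappa=\omega^\xi+\alpha$). *)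

theory Defs
  imports "HOL-Analysis.Analysis"
begin

text \<open>Countable ordinals are represented by Brouwer trees (limits of nat-indexed
sequences); every countable ordinal is the value of such a tree and conversely.
Different trees may denote the same ordinal; the ordinal order on values is
the inductive relation cord_le below, and all operations below respect values.\<close>

datatype cord = OZero | OSucc cord | OLim "nat \<Rightarrow> cord"

inductive cord_le :: "cord \<Rightarrow> cord \<Rightarrow> bool" where
  zero: "cord_le OZero y"
| succ: "cord_le x y \<Longrightarrow> cord_le (OSucc x) (OSucc y)"
| succ_right: "cord_le x y \<Longrightarrow> cord_le x (OSucc y)"
| lim_left: "(\<And>n. cord_le (f n) y) \<Longrightarrow> cord_le (OLim f) y"
| lim_right: "cord_le x (f n) \<Longrightarrow> cord_le x (OLim f)"

definition cord_less :: "cord \<Rightarrow> cord \<Rightarrow> bool" where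
  "cord_less x y \<longleftrightarrow> cord_le (OSucc x) y"

definition cord_eq :: "cord \<Rightarrow> cord \<Rightarrow> bool" where
  "cord_eq x y \<longleftrightarrow> cord_le x y \<and> cord_le y x"

primrec cord_add :: "cord \<Rightarrow> cord \<Rightarrow> cord" where
  "cord_add a OZero = a"
| "cord_add a (OSucc b) = OSucc (cord_add a b)"
| "cord_add a (OLim f) = OLim (\<lambda>n. cord_add a (f n))"

primrec cord_mul_nat :: "cord \<Rightarrow> nat \<Rightarrow> cord" where
  "cord_mul_nat a 0 = OZero"
| "cord_mul_nat a (Suc n) = cord_add (cord_mul_nat a n) a"

primrec cord_wexp :: "cord \<Rightarrow> cord" where
  "cord_wexp OZero = OSucc OZero"
| "cord_wexp (OSucc a) = OLim (\<lambda>n. cord_mul_nat (cord_wexp a) n)"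
| "cord_wexp (OLim f) = OLim (\<lambda>n. cord_wexp (f n))"

text \<open>Transfinite iteration of a derivation: d^0 P = P, d^(a+1) P = d (d^a P),
intersection at limits.  (For derivations, i.e. d P \<subseteq> P, the iterates are
decreasing, so the intersection over the sequence equals the intersection
over all smaller ordinals.)\<close>
primrec deriv_iter :: "('a set \<Rightarrow> 'a set) \<Rightarrow> cord \<Rightarrow> 'a set \<Rightarrow> 'a set" where
  "deriv_iter d OZero P = P"
| "deriv_iter d (OSucc a) P = d (deriv_iter d a P)"
| "deriv_iter d (OLim f) P = (\<Inter>n. deriv_iter d (f n) P)"

definition baire1 :: "('a::topological_space \<Rightarrow> real) \<Rightarrow> bool" where
  "baire1 f \<longleftrightarrow> (\<exists>g::nat \<Rightarrow> 'a \<Rightarrow> real. (\<forall>n. continuous_on UNIV (g n)) \<and>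
      (\<forall>x. (\<lambda>n. g n x) \<longlonglongrightarrow> f x))"

definition osc_der :: "('a::topological_space \<Rightarrow> real) \<Rightarrow> real \<Rightarrow> 'a set \<Rightarrow> 'a set" where
  "osc_der f eps F = {x \<in> F. \<forall>U. open U \<and> x \<in> U \<longrightarrow>
      (\<exists>x1 \<in> F \<inter> U. \<exists>x2 \<in> F \<inter> U. \<bar>f x1 - f x2\<bar> \<ge> eps)}"

text \<open>beta(f) \<le> g: for every eps > 0 the least a with D^a(f,eps,X) empty exists
and is \<le> g (if no such a exists, beta(f,eps) = omega_1 > g).\<close>
definition osc_rank_le :: "('a::topological_space \<Rightarrow> real) \<Rightarrow> cord \<Rightarrow> bool" where
  "osc_rank_le f g \<longleftrightarrow> (\<forall>eps>0. \<exists>a. cord_le a g \<and> deriv_iter (osc_der f eps) a UNIV = {})"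

definition B1 :: "cord \<Rightarrow> ('a::topological_space \<Rightarrow> real) set" where
  "B1 lam = {f. baire1 f \<and> osc_rank_le f (cord_wexp lam)}"

definition Mult :: "cord \<Rightarrow> cord \<Rightarrow> ('a::topological_space \<Rightarrow> real) set" where
  "Mult kap lam = {h. \<forall>f \<in> B1 kap. (\<lambda>x. h x * f x) \<in> B1 lam}"

definition acc :: "'a::topological_space set \<Rightarrow> 'a set" where
  "acc A = {x. x islimpt A}"

definition hM :: "('a::topological_space \<Rightarrow> real) \<Rightarrow> real \<Rightarrow> 'a set \<Rightarrow> 'a set" where
  "hM h M P = acc (P \<inter> {x. \<bar>h x\<bar> > M})"

definition O_set :: "('a::topological_space \<Rightarrow> real) \<Rightarrow> real \<Rightarrow> 'a set \<Rightarrow> 'a set" where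
  "O_set h eps P = {x \<in> P. \<forall>U. open U \<and> x \<in> U \<longrightarrow> (\<exists>y \<in> U \<inter> P. \<bar>h y - h x\<bar> \<ge> eps)}"

definition delta :: "('a::topological_space \<Rightarrow> real) \<Rightarrow> real \<Rightarrow> 'a set \<Rightarrow> 'a set" where
  "delta h eps P = closure (O_set h eps P)"

text \<open>Omega_{h,xi}(P), relative to the fixed sequence xis n strictly increasing to
omega^(omega^xi).\<close>
definition Omega :: "('a::topological_space \<Rightarrow> real) \<Rightarrow> (nat \<Rightarrow> cord) \<Rightarrow> 'a set \<Rightarrow> 'a set" where
  "Omega h xis P = (\<Inter>n. acc (\<Union>eta \<in> {eta. eta > 0}. deriv_iter (delta h eta) (xis n) P))"

text \<open>kappa ~ (xi, alpha): xi is the leading Cantor-normal-form exponent of kappa,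
i.e. omega^xi \<le> kappa < omega^(xi+1), and kappa = omega^xi + alpha.\<close>
definition cnf_split :: "cord \<Rightarrow> cord \<Rightarrow> cord \<Rightarrow> bool" where
  "cnf_split kap xi al \<longleftrightarrow> cord_le (cord_wexp xi) kap \<and> cord_less kap (cord_wexp (OSucc xi))
     \<and> cord_eq kap (cord_add (cord_wexp xi) al)"

end

theory Submission
  imports Defs
begin

text \<open>
Write \<open>\<Gamma> = \<omega>\<^bsup>\<omega>\<^sup>\<xi>\<^esup>\<close>, so that \<open>\<omega>\<^sup>\<kappa> = \<Gamma> \<omega>\<^sup>\<alpha>\<close>. Since \<open>\<Gamma>\<close> is closed under multiplication,
\<open>\<delta>\<^sup>\<Gamma>(hf, \<epsilon>, P) \<subseteq> \<delta>\<^sup>\<Gamma>(f, \<epsilon>/4M, P) \<union> h\<^sub>M\<^sup>\<Gamma>(P) \<union> \<Omega>(P)\<close> for all closed \<open>P\<close>. The derivation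
on the left is additive in \<open>P\<close> and \<open>\<omega>\<^sup>\<alpha>\<close> is closed under natural sums, so this inclusion survives
\<open>\<omega>\<^sup>\<alpha>\<close>-fold iteration, which gives sufficiency.

If one of the conditions fails at a point \<open>x\<close>, a witness \<open>f\<close> is built along a countable closed
tree with root \<open>x\<close>, whose subtrees lie in disjoint balls shrinking to their parent, with \<open>f = 0\<close>
off the tree. When the first condition fails, \<open>f\<close> takes small values on the points where \<open>h\<close> is
large. When the second fails, \<open>f\<close> is constant on the trees that witness the iterated oscillation
of \<open>h\<close> by \<open>\<eta>\<close>, with the value \<open>2/\<eta>\<close>, so that one derivative of \<open>f\<close> corresponds to \<open>\<Gamma>\<close>
derivatives of the product.

No separate argument is needed for the first Baire class, since countable oscillation rank implies it.
\<close>

section \<open>Arithmetic of countable ordinals\<close>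

text \<open>The inclusion for the product is a count. Near a point y outside the right-hand side,
  and with y deleted, some c < \<Gamma> exhausts \<open>f\<close>, \<open>hM\<close> and, for every
  threshold, \<open>h\<close>. Where |h| \<le> M and \<open>f\<close> is nearly constant, the
  product can vary only if \<open>h\<close> does; so c derivatives of the product cost one of
  \<open>f\<close>, and c * c leave nothing. Near a point outside h_M(P) only that point can have
  |h| > M, and one more derivative removes it. So c * c + 1 derivatives cost one step of
  \<open>hM\<close>, and (c * c + 1) * c is still below \<Gamma>.

  \<open>osc_der\<close> compares two arbitrary points, which may lie in different pieces of a
  union, so it is not additive. \<open>O_set\<close> fixes one of them at the centre; the factor 2
  between the two notions is harmless since all e > 0 are considered.

  In the trees, a parent must prescribe the values at the roots of its children. Therefore
  \<open>hM_tree\<close> and \<open>Omega_tree\<close> speak of all functions that agree off the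
  root.\<close>

lemma cord_le_refl [simp]: "cord_le x x"
proof (induction x)
  case (OLim f)
  then show ?case
    by (intro cord_le.lim_left cord_le.lim_right) auto
qed (auto intro: cord_le.intros)

lemma cord_le_LimD:
  assumes "cord_le (OLim f) y" shows "cord_le (f n) y"
  using assms by (induction "OLim f" y) (auto intro: cord_le.intros)

lemma cord_le_SucD:
  assumes "cord_le (OSucc x) y" shows "cord_le x y"
  using assms by (induction "OSucc x" y) (auto intro: cord_le.intros)

lemma cord_le_trans [trans]:
  assumes "cord_le x y" "cord_le y z" shows "cord_le x z"
  using assms
proof (induction arbitrary: z)
  case (succ x y)
  from succ.prems succ.IH show ?case
    by (induction "OSucc y" z) (auto intro: cord_le.intros)
qed (auto intro: cord_le.intros dest: cord_le_SucD cord_le_LimD)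

lemma cord_le_Suc_iff [simp]: "cord_le (OSucc x) (OSucc y) \<longleftrightarrow> cord_le x y"
  by (auto intro: cord_le.intros elim: cord_le.cases dest: cord_le_SucD)

lemma cord_le_Lim_iff: "cord_le (OLim f) y \<longleftrightarrow> (\<forall>n. cord_le (f n) y)"
  by (auto intro: cord_le.intros dest: cord_le_LimD)

lemma Suc_cord_le_Lim_iff: "cord_le (OSucc x) (OLim f) \<longleftrightarrow> (\<exists>n. cord_le (OSucc x) (f n))"
  by (auto intro: cord_le.intros elim: cord_le.cases)

lemma Suc_not_cord_le_zero [simp]: "\<not> cord_le (OSucc x) OZero"
  by (auto elim: cord_le.cases)

lemma cord_le_Lim: "cord_le (f n) (OLim f)"
  by (rule cord_le.lim_right[OF cord_le_refl])

lemma cord_le_total: "cord_le x y \<or> cord_le (OSucc y) x"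
proof (induction x arbitrary: y)
  case (OSucc x)
  show ?case
  proof (induction y)
    case (OLim g)
    then show ?case
      by (cases "\<exists>n. cord_le (OSucc x) (g n)") (auto simp: cord_le_Lim_iff intro: cord_le.intros)
  qed (use OSucc in \<open>auto intro: cord_le.intros\<close>)
next
  case (OLim f)
  then show ?case
    by (auto simp: cord_le_Lim_iff Suc_cord_le_Lim_iff)
qed (auto intro: cord_le.intros)

lemma cord_le_linear: "cord_le x y \<or> cord_le y x"
  using cord_le_total[of x y] by (auto dest: cord_le_SucD)

lemma Suc_not_cord_le_self [simp]: "\<not> cord_le (OSucc x) x"
proof (induction x)
  case (OLim f)
  show ?case
  proof
    assume "cord_le (OSucc (OLim f)) (OLim f)"
    then obtain n where "cord_le (OSucc (OLim f)) (f n)"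
      by (auto simp: Suc_cord_le_Lim_iff)
    moreover have "cord_le (OSucc (f n)) (OSucc (OLim f))"
      by (simp add: cord_le_Lim)
    ultimately show False
      using OLim cord_le_trans by blast
  qed
qed auto

text \<open>Merges successor and limit: a nonzero ordinal is the supremum of the successors of
  countably many smaller ones. Constructions along an ordinal then have a single inductive
  step.\<close>

lemma cord_sup_representation:
  "cord_le a OZero \<or> (\<exists>s. cord_eq a (OLim (\<lambda>n. OSucc (s n))))"
proof (induction a)
  case (OSucc a)
  have "cord_eq (OSucc a) (OLim (\<lambda>n. OSucc a))"
    by (auto simp: cord_eq_def intro: cord_le.intros)
  then show ?case by (intro disjI2 exI[of _ "\<lambda>_. a"])
next
  case (OLim f)
  show ?case
  proof (cases "\<forall>n. cord_le (f n) OZero")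
    case False
    then obtain n0 where n0: "\<not> cord_le (f n0) OZero"
      by auto
    have "\<exists>t. cord_le (OLim (\<lambda>k. OSucc (t k))) (OLim f) \<and> cord_le (f n) (OLim (\<lambda>k. OSucc (t k)))" for n
    proof -
      \<comment> \<open>A member of value 0 has no such representation; the nonzero member
        \<open>n0\<close> stands in for it.\<close>
      define m where "m = (if cord_le (f n) OZero then n0 else n)"
      obtain t where "cord_eq (f m) (OLim (\<lambda>k. OSucc (t k)))"
        using OLim[of "f m"] n0 by (auto simp: m_def split: if_splits)
      moreover have "cord_le (f n) (f m)"
        by (auto simp: m_def intro: cord_le_trans[OF _ cord_le.zero])
      ultimately show ?thesis
        unfolding cord_eq_def using cord_le_trans cord_le_Lim by meson
    qed
    then obtain t where t: "\<And>n. cord_le (OLim (\<lambda>k. OSucc (t n k))) (OLim f)"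
      "\<And>n. cord_le (f n) (OLim (\<lambda>k. OSucc (t n k)))"
      by metis
    let ?s = "\<lambda>j. case prod_decode j of (n, k) \<Rightarrow> t n k"
    have le: "cord_le (OLim (\<lambda>k. OSucc (t n k))) (OLim (\<lambda>j. OSucc (?s j)))" for n
      unfolding cord_le_Lim_iff
    proof
      fix k
      show "cord_le (OSucc (t n k)) (OLim (\<lambda>j. OSucc (?s j)))"
        using cord_le_Lim[of "\<lambda>j. OSucc (?s j)" "prod_encode (n, k)"] by simp
    qed
    have "cord_eq (OLim f) (OLim (\<lambda>j. OSucc (?s j)))"
      unfolding cord_eq_def
    proof
      show "cord_le (OLim f) (OLim (\<lambda>j. OSucc (?s j)))"
        using cord_le_trans[OF t(2) le] by (simp add: cord_le_Lim_iff)
      show "cord_le (OLim (\<lambda>j. OSucc (?s j))) (OLim f)"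
        using cord_le_LimD[OF t(1)] by (auto simp: cord_le_Lim_iff[of "\<lambda>j. OSucc (?s j)"] split: prod.splits)
    qed
    then show ?thesis by (intro disjI2 exI[of _ ?s])
  qed (auto simp: cord_le_Lim_iff)
qed auto

text \<open>The \<open>s n\<close> are below \<open>a\<close> in value but need not occur in the
  tree \<open>a\<close>, so structural induction does not reach them. The proof therefore shows
  \<open>P b\<close> for all \<open>b\<close> below \<open>a\<close>.\<close>

lemma cord_sup_induct [case_names zero sup]:
  assumes zero: "\<And>a. cord_le a OZero \<Longrightarrow> P a"
    and sup: "\<And>a s. cord_eq a (OLim (\<lambda>n. OSucc (s n))) \<Longrightarrow> (\<And>n. P (s n)) \<Longrightarrow> P a"
  shows "P a"
proof -
  have "cord_le b a \<Longrightarrow> P b" for b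
  proof (induction a arbitrary: b)
    case OZero
    then show ?case using zero by blast
  next
    case (OSucc a)
    show ?case
    proof (cases "cord_le b OZero")
      case False
      then obtain s where s: "cord_eq b (OLim (\<lambda>n. OSucc (s n)))"
        using cord_sup_representation by blast
      have "cord_le (OSucc (s n)) (OSucc a)" for n
        using s OSucc.prems cord_le_LimD cord_le_trans unfolding cord_eq_def by meson
      then show ?thesis
        using sup[OF s] OSucc.IH by simp
    qed (use zero in blast)
  next
    case (OLim f)
    show ?case
    proof (cases "cord_le b OZero")
      case False
      then obtain s where s: "cord_eq b (OLim (\<lambda>n. OSucc (s n)))"
        using cord_sup_representation by blast
      have "cord_le (OSucc (s n)) (OLim f)" for n
        using s OLim.prems cord_le_LimD cord_le_trans unfolding cord_eq_def by meson
      then have "\<exists>m. cord_le (s n) (f m)" for n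
        unfolding Suc_cord_le_Lim_iff by (meson cord_le_SucD)
      then show ?thesis
        using sup[OF s] OLim.IH by blast
    qed (use zero in blast)
  qed
  then show ?thesis by simp
qed

section \<open>Sums and products\<close>

lemma cord_add_assoc: "cord_add (cord_add a b) c = cord_add a (cord_add b c)"
  by (induction c) auto

lemma cord_add_mono_left: "cord_le a a' \<Longrightarrow> cord_le (cord_add a b) (cord_add a' b)"
  by (induction b) (auto simp: cord_le_Lim_iff intro: cord_le.intros)

lemma cord_le_add_left: "cord_le a (cord_add a b)"
  by (induction b) (auto intro: cord_le.intros)

lemma cord_le_add_right: "cord_le b (cord_add a b)"
  by (induction b) (auto simp: cord_le_Lim_iff intro: cord_le.intros)

lemma cord_add_mono_right: "cord_le b b' \<Longrightarrow> cord_le (cord_add a b) (cord_add a b')"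
  by (induction rule: cord_le.induct) (auto simp: cord_le_add_left intro: cord_le.intros)

lemma cord_add_mono:
  "cord_le a a' \<Longrightarrow> cord_le b b' \<Longrightarrow> cord_le (cord_add a b) (cord_add a' b')"
  using cord_add_mono_left cord_add_mono_right cord_le_trans by blast

lemma cord_add_zero_left: "cord_le (cord_add OZero b) b"
  by (induction b) (auto simp: cord_le_Lim_iff intro: cord_le.intros)

primrec cord_mul :: "cord \<Rightarrow> cord \<Rightarrow> cord" where
  "cord_mul a OZero = OZero"
| "cord_mul a (OSucc b) = cord_add (cord_mul a b) a"
| "cord_mul a (OLim f) = OLim (\<lambda>n. cord_mul a (f n))"

primrec cord_of_nat :: "nat \<Rightarrow> cord" where
  "cord_of_nat 0 = OZero"
| "cord_of_nat (Suc n) = OSucc (cord_of_nat n)"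

lemma cord_mul_nat_eq: "cord_mul_nat a n = cord_mul a (cord_of_nat n)"
  by (induction n) auto

lemma cord_mul_mono_right: "cord_le b b' \<Longrightarrow> cord_le (cord_mul a b) (cord_mul a b')"
proof (induction rule: cord_le.induct)
  case (succ_right x y)
  then show ?case
    using cord_le_trans[OF _ cord_le_add_left] by auto
qed (auto simp: cord_add_mono_left intro: cord_le.intros)

lemma cord_mul_mono_left: "cord_le a a' \<Longrightarrow> cord_le (cord_mul a b) (cord_mul a' b)"
  by (induction b) (auto simp: cord_add_mono cord_le_Lim_iff intro: cord_le.intros)

lemma cord_mul_mono:
  "cord_le a a' \<Longrightarrow> cord_le b b' \<Longrightarrow> cord_le (cord_mul a b) (cord_mul a' b')"
  using cord_mul_mono_left cord_mul_mono_right cord_le_trans by blast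

lemma cord_mul_add_distrib: "cord_mul a (cord_add b c) = cord_add (cord_mul a b) (cord_mul a c)"
  by (induction c) (auto simp: cord_add_assoc)

lemma cord_mul_assoc: "cord_mul (cord_mul a b) c = cord_mul a (cord_mul b c)"
  by (induction c) (auto simp: cord_mul_add_distrib)

lemma cord_mul_of_nat_add:
  "cord_mul a (cord_of_nat (m + n)) = cord_add (cord_mul a (cord_of_nat m)) (cord_mul a (cord_of_nat n))"
  by (induction n) (auto simp: cord_add_assoc)

lemma cord_of_nat_add: "cord_of_nat (m + n) = cord_add (cord_of_nat m) (cord_of_nat n)"
  by (induction n) auto

lemma cord_of_nat_mult: "cord_of_nat (m * n) = cord_mul (cord_of_nat m) (cord_of_nat n)"
  by (induction n) (auto simp: cord_of_nat_add add.commute[of m])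

lemma cord_le_mul_one: "cord_le a (cord_mul a (cord_of_nat (Suc n)))"
  by (simp add: cord_le_add_right)

section \<open>Powers of omega and their indecomposability\<close>

lemma one_le_cord_wexp: "cord_le (OSucc OZero) (cord_wexp a)"
proof (induction a)
  case (OSucc a)
  then have "cord_le (OSucc OZero) (cord_mul_nat (cord_wexp a) (Suc 0))"
    using cord_le_trans[OF _ cord_le_mul_one] by (simp only: cord_mul_nat_eq)
  then show ?case
    by (simp only: cord_wexp.simps Suc_cord_le_Lim_iff) blast
qed (auto simp: Suc_cord_le_Lim_iff)

lemma Suc_cord_mul_wexp_le:
  "cord_le (OSucc (cord_mul (cord_wexp a) (cord_of_nat n))) (cord_wexp (OSucc a))"
proof -
  have "cord_le (OSucc (cord_mul (cord_wexp a) (cord_of_nat n)))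
      (cord_mul (cord_wexp a) (cord_of_nat (Suc n)))"
    using cord_add_mono_right[OF one_le_cord_wexp, of "cord_mul (cord_wexp a) (cord_of_nat n)" a]
    by simp
  then show ?thesis
    by (simp only: cord_wexp.simps Suc_cord_le_Lim_iff cord_mul_nat_eq) blast
qed

lemma cord_wexp_less_Suc: "cord_le (OSucc (cord_wexp a)) (cord_wexp (OSucc a))"
proof -
  have "cord_le (OSucc (cord_wexp a)) (OSucc (cord_mul (cord_wexp a) (cord_of_nat (Suc 0))))"
    by (simp only: cord_le_Suc_iff cord_le_mul_one)
  then show ?thesis
    using Suc_cord_mul_wexp_le cord_le_trans by blast
qed

lemma cord_wexp_mono: "cord_le a b \<Longrightarrow> cord_le (cord_wexp a) (cord_wexp b)"
proof (induction rule: cord_le.induct)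
  case (zero y)
  then show ?case using one_le_cord_wexp by simp
next
  case (succ x y)
  then show ?case
    by (auto simp: cord_mul_nat_eq cord_le_Lim_iff intro: cord_le.intros cord_mul_mono_left)
next
  case (succ_right x y)
  then show ?case
    using cord_wexp_less_Suc cord_le_SucD cord_le_trans by blast
qed (auto intro: cord_le.intros)

lemma cord_wexp_less: "cord_le (OSucc a) b \<Longrightarrow> cord_le (OSucc (cord_wexp a)) (cord_wexp b)"
  using cord_wexp_less_Suc cord_wexp_mono cord_le_trans by blast

lemma cord_wexp_eq: "cord_eq a b \<Longrightarrow> cord_eq (cord_wexp a) (cord_wexp b)"
  by (simp add: cord_eq_def cord_wexp_mono)

text \<open>A bound by the leading Cantor term. The case c = 0 is separate because b = 0 leaves no g
  below it.\<close>

lemma cord_less_wexp_cases: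
  assumes "cord_le (OSucc c) (cord_wexp b)"
  shows "cord_le c OZero \<or>
    (\<exists>g k. cord_le (OSucc g) b \<and> cord_le c (cord_mul (cord_wexp g) (cord_of_nat k)))"
  using assms
proof (induction b)
  case (OSucc b)
  then show ?case
    by (auto simp: Suc_cord_le_Lim_iff cord_mul_nat_eq) (meson cord_le_SucD cord_le_refl)
next
  case (OLim f)
  then obtain n where "cord_le (OSucc c) (cord_wexp (f n))"
    by (auto simp: Suc_cord_le_Lim_iff)
  then show ?case
    using OLim.IH[of "f n"] cord_le.lim_right[of _ f n] by blast
qed auto

text \<open>Additive indecomposability: at a successor exponent the coefficients add up to m + n,
  and at a limit both summands move to the larger of the two stages.\<close>

lemma cord_add_less_wexp:
  assumes "cord_le (OSucc a) (cord_wexp x)" "cord_le (OSucc b) (cord_wexp x)"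
  shows "cord_le (OSucc (cord_add a b)) (cord_wexp x)"
  using assms
proof (induction x)
  case OZero
  then show ?case
    using cord_add_mono[of a OZero b OZero] by simp
next
  case (OSucc x)
  then obtain m n where "cord_le (OSucc a) (cord_mul (cord_wexp x) (cord_of_nat m))"
      "cord_le (OSucc b) (cord_mul (cord_wexp x) (cord_of_nat n))"
    by (auto simp: Suc_cord_le_Lim_iff cord_mul_nat_eq)
  then have "cord_le (cord_add a (OSucc b)) (cord_mul (cord_wexp x) (cord_of_nat (m + n)))"
    unfolding cord_mul_of_nat_add using cord_add_mono cord_le_SucD by blast
  then show ?case
    by (auto simp: Suc_cord_le_Lim_iff cord_mul_nat_eq)
next
  case (OLim f)
  then obtain m n where "cord_le (OSucc a) (cord_wexp (f m))" "cord_le (OSucc b) (cord_wexp (f n))"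
    by (auto simp: Suc_cord_le_Lim_iff)
  then have "cord_le (OSucc a) (cord_wexp (f n)) \<and> cord_le (OSucc b) (cord_wexp (f n)) \<or>
      cord_le (OSucc a) (cord_wexp (f m)) \<and> cord_le (OSucc b) (cord_wexp (f m))"
    using cord_le_linear[of "f m" "f n"] cord_wexp_mono cord_le_trans by meson
  then have "\<exists>k. cord_le (OSucc (cord_add a b)) (cord_wexp (f k))"
    using OLim.IH by blast
  then show ?case
    by (auto simp: Suc_cord_le_Lim_iff)
qed

lemma one_less_cord_wexp:
  assumes "cord_le (OSucc OZero) x"
  shows "cord_le (OSucc (OSucc OZero)) (cord_wexp x)"
  using cord_wexp_less[OF assms] by simp

lemma Suc_less_cord_wexp:
  assumes "cord_le (OSucc OZero) x" "cord_le (OSucc a) (cord_wexp x)"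
  shows "cord_le (OSucc (OSucc a)) (cord_wexp x)"
  using cord_add_less_wexp[OF assms(2) one_less_cord_wexp[OF assms(1)]] by simp

text \<open>Absorption on the left. It later makes one initial derivative, which confines everything
  to part of a tree, free of charge.\<close>

lemma one_plus_cord_wexp:
  assumes "cord_le (OSucc OZero) x"
  shows "cord_le (cord_add (OSucc OZero) (cord_wexp x)) (cord_wexp x)"
proof -
  have "\<not> cord_le (cord_wexp x) OZero"
    using one_le_cord_wexp cord_le_trans Suc_not_cord_le_zero by blast
  then obtain s where s: "cord_eq (cord_wexp x) (OLim (\<lambda>n. OSucc (s n)))"
    using cord_sup_representation by blast
  have "cord_le (OSucc (cord_add (OSucc OZero) (s n))) (cord_wexp x)" for n
    using s cord_le_LimD cord_add_less_wexp one_less_cord_wexp[OF assms]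
    unfolding cord_eq_def by blast
  then have "cord_le (cord_add (OSucc OZero) (OLim (\<lambda>n. OSucc (s n)))) (cord_wexp x)"
    by (simp add: cord_le_Lim_iff)
  then show ?thesis
    using s cord_add_mono_right cord_le_trans unfolding cord_eq_def by blast
qed

lemma cord_wexp_mult_le: "cord_le (cord_mul (cord_wexp a) (cord_wexp b)) (cord_wexp (cord_add a b))"
proof (induction b)
  case OZero
  then show ?case by (simp add: cord_add_zero_left)
next
  case (OSucc b)
  then show ?case
    by (auto simp: cord_mul_nat_eq cord_le_Lim_iff cord_mul_assoc[symmetric]
        intro: cord_le.intros cord_mul_mono_left)
next
  case (OLim f)
  then show ?case
    by (auto simp: cord_le_Lim_iff intro: cord_le.intros)
qed

text \<open>Moves a finite coefficient past a power of omega. For g > 0 the left side is just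
  omega^g; the coefficient on the right serves the case g = 0.\<close>

lemma cord_of_nat_mult_wexp_le:
  "cord_le (cord_mul (cord_of_nat (Suc k)) (cord_wexp g))
     (cord_mul (cord_wexp g) (cord_of_nat (Suc k)))"
proof (induction g)
  case OZero
  have "cord_mul (OSucc OZero) (cord_of_nat n) = cord_of_nat n" for n
    by (induction n) auto
  from this[of "Suc k"] cord_add_zero_left[of "cord_of_nat (Suc k)"] show ?case
    by simp
next
  case (OSucc g)
  have "cord_le (cord_mul (cord_of_nat (Suc k)) (cord_mul (cord_wexp g) (cord_of_nat n)))
      (cord_wexp (OSucc g))" for n
  proof -
    have "cord_le (cord_mul (cord_of_nat (Suc k)) (cord_mul (cord_wexp g) (cord_of_nat n)))
      (cord_mul (cord_wexp g) (cord_of_nat (Suc k * n)))"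
      unfolding cord_of_nat_mult cord_mul_assoc[symmetric]
      using OSucc by (rule cord_mul_mono_left)
    then show ?thesis
      using Suc_cord_mul_wexp_le cord_le_SucD cord_le_trans by blast
  qed
  then have "cord_le (cord_mul (cord_of_nat (Suc k)) (cord_wexp (OSucc g))) (cord_wexp (OSucc g))"
    by (simp add: cord_mul_nat_eq cord_le_Lim_iff)
  then show ?case
    using cord_le_mul_one cord_le_trans by blast
next
  case (OLim f)
  have "cord_le (cord_mul (cord_of_nat (Suc k)) (cord_wexp (f n)))
      (cord_mul (cord_wexp (OLim f)) (cord_of_nat (Suc k)))" for n
    using OLim[of "f n"] cord_mul_mono_left[OF cord_wexp_mono[OF cord_le_Lim[of f n]]]
      cord_le_trans by blast
  then show ?case
    by (simp add: cord_le_Lim_iff)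
qed

text \<open>Multiplicative indecomposability. From a \<le> omega^g * k and b \<le> omega^g' * m
  follows a * b \<le> omega^(g + g') * (k * m), and g + g' < omega^x because omega^x is additively
  indecomposable.\<close>

lemma cord_mul_less_wexp_wexp:
  assumes a: "cord_le (OSucc a) (cord_wexp (cord_wexp x))"
    and b: "cord_le (OSucc b) (cord_wexp (cord_wexp x))"
  shows "cord_le (OSucc (cord_mul a b)) (cord_wexp (cord_wexp x))"
proof -
  have *: "\<exists>g k. cord_le (OSucc g) (cord_wexp x) \<and> cord_le c (cord_mul (cord_wexp g) (cord_of_nat (Suc k)))"
    if "cord_le (OSucc c) (cord_wexp (cord_wexp x))" for c
    using cord_less_wexp_cases[OF that]
  proof
    assume "cord_le c OZero"
    then show ?thesis
      using one_le_cord_wexp cord_le_trans[OF _ cord_le.zero] by blast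
  next
    assume "\<exists>g k. cord_le (OSucc g) (cord_wexp x) \<and> cord_le c (cord_mul (cord_wexp g) (cord_of_nat k))"
    then show ?thesis
      using cord_le_trans[OF _ cord_mul_mono_right[OF cord_le.succ_right[OF cord_le_refl]]]
      by (metis cord_of_nat.simps(2))
  qed
  obtain g k where g: "cord_le (OSucc g) (cord_wexp x)"
      "cord_le a (cord_mul (cord_wexp g) (cord_of_nat (Suc k)))"
    using *[OF a] by blast
  obtain g' m where g': "cord_le (OSucc g') (cord_wexp x)"
      "cord_le b (cord_mul (cord_wexp g') (cord_of_nat (Suc m)))"
    using *[OF b] by blast
  let ?k = "cord_of_nat (Suc k)" and ?m = "cord_of_nat (Suc m)"
  have "cord_le (cord_mul a b) (cord_mul (cord_mul (cord_wexp g) ?k) (cord_mul (cord_wexp g') ?m))"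
    by (rule cord_mul_mono[OF g(2) g'(2)])
  also have "\<dots> = cord_mul (cord_mul (cord_wexp g) (cord_mul ?k (cord_wexp g'))) ?m"
    by (simp only: cord_mul_assoc)
  also have "cord_le \<dots> (cord_mul (cord_mul (cord_wexp g) (cord_mul (cord_wexp g') ?k)) ?m)"
    by (intro cord_mul_mono_left cord_mul_mono_right cord_of_nat_mult_wexp_le)
  also have "\<dots> = cord_mul (cord_mul (cord_wexp g) (cord_wexp g')) (cord_of_nat (Suc k * Suc m))"
    by (simp only: cord_mul_assoc cord_of_nat_mult)
  also have "cord_le \<dots> (cord_mul (cord_wexp (cord_add g g')) (cord_of_nat (Suc k * Suc m)))"
    by (intro cord_mul_mono_left cord_wexp_mult_le)
  finally have "cord_le (OSucc (cord_mul a b))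
      (OSucc (cord_mul (cord_wexp (cord_add g g')) (cord_of_nat (Suc k * Suc m))))"
    by simp
  also have "cord_le \<dots> (cord_wexp (OSucc (cord_add g g')))"
    by (rule Suc_cord_mul_wexp_le)
  also have "cord_le \<dots> (cord_wexp (cord_wexp x))"
    by (intro cord_wexp_mono cord_add_less_wexp g g')
  finally show ?thesis .
qed

text \<open>If kap \<le> al, then omega^xi + kap \<le> kap, and repetition gives omega^xi * n \<le>
  kap for all n, against kap < omega^(xi + 1). The strict inequality leaves room below omega^kap for
  a witness built along omega^al.\<close>

lemma cnf_split_less:
  assumes "cnf_split kap xi al"
  shows "cord_le (OSucc al) kap"
proof (rule ccontr)
  assume "\<not> cord_le (OSucc al) kap"
  then have "cord_le kap al"
    using cord_le_total by blast
  with assms have le: "cord_le (cord_add (cord_wexp xi) kap) kap"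
    unfolding cnf_split_def cord_eq_def using cord_add_mono_right cord_le_trans by blast
  have *: "cord_le (cord_add (cord_mul_nat (cord_wexp xi) n) kap) kap" for n
  proof (induction n)
    case 0
    then show ?case by (simp add: cord_add_zero_left)
  next
    case (Suc n)
    then show ?case
      using le cord_add_mono_right cord_le_trans by (simp add: cord_add_assoc) blast
  qed
  obtain n where "cord_le (OSucc kap) (cord_mul_nat (cord_wexp xi) n)"
    using assms by (auto simp: cnf_split_def cord_less_def Suc_cord_le_Lim_iff)
  then have "cord_le (OSucc kap) kap"
    using *[of n] cord_le_add_left cord_le_trans by blast
  then show False by simp
qed

section \<open>Derivations and their iterates\<close>

text \<open>Monotonicity on closed sets is made part of the notion, since all comparisons of
  iterates rest on it.\<close>

definition derivation :: "('a::topological_space set \<Rightarrow> 'a set) \<Rightarrow> bool" where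
  "derivation d \<longleftrightarrow> (\<forall>P. closed P \<longrightarrow> closed (d P) \<and> d P \<subseteq> P) \<and>
     (\<forall>P Q. closed P \<longrightarrow> closed Q \<longrightarrow> P \<subseteq> Q \<longrightarrow> d P \<subseteq> d Q)"

lemma derivation_closed: "derivation d \<Longrightarrow> closed P \<Longrightarrow> closed (d P)"
  unfolding derivation_def by blast

lemma derivation_subset: "derivation d \<Longrightarrow> closed P \<Longrightarrow> d P \<subseteq> P"
  unfolding derivation_def by blast

lemma derivation_mono: "derivation d \<Longrightarrow> closed P \<Longrightarrow> closed Q \<Longrightarrow> P \<subseteq> Q \<Longrightarrow> d P \<subseteq> d Q"
  unfolding derivation_def by blast

lemma deriv_iter_rel:
  assumes "Rel P Q" and "\<And>A B. Rel A B \<Longrightarrow> Rel (d A) (d' B)"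
    and "\<And>A B. (\<And>n::nat. Rel (A n) (B n)) \<Longrightarrow> Rel (\<Inter>n. A n) (\<Inter>n. B n)"
  shows "Rel (deriv_iter d a P) (deriv_iter d' a Q)"
proof (induction a)
  case OZero
  show ?case using assms(1) by simp
next
  case (OSucc a)
  then show ?case using assms(2) by simp
next
  case (OLim f)
  then show ?case by (simp add: assms(3))
qed

lemma derivation_iter:
  assumes d: "derivation d" shows "derivation (deriv_iter d a)"
proof -
  have sub: "deriv_iter d a P \<subseteq> P \<and> closed (deriv_iter d a P)" if "closed P" for P
  proof (induction a)
    case (OSucc a)
    then show ?case
      using derivation_subset[OF d, of "deriv_iter d a P"] derivation_closed[OF d] by auto
  next
    case (OLim f)
    then show ?case
      using closed_INT[of UNIV "\<lambda>n. deriv_iter d (f n) P"] by auto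
  qed (use that in simp)
  have mono: "deriv_iter d a P \<subseteq> deriv_iter d a Q \<and> closed (deriv_iter d a P) \<and> closed (deriv_iter d a Q)"
    if "closed P" "closed Q" "P \<subseteq> Q" for P Q
  proof (induction a)
    case (OSucc a)
    then show ?case
      using derivation_mono[OF d, of "deriv_iter d a P" "deriv_iter d a Q"] derivation_closed[OF d]
      by auto
  next
    case (OLim f)
    then have "deriv_iter d (f n) P \<subseteq> deriv_iter d (f n) Q" for n
      by simp
    then have "(\<Inter>n. deriv_iter d (f n) P) \<subseteq> (\<Inter>n. deriv_iter d (f n) Q)"
      by (intro INF_mono) auto
    with OLim show ?case
      using closed_INT[of UNIV "\<lambda>n. deriv_iter d (f n) P"] closed_INT[of UNIV "\<lambda>n. deriv_iter d (f n) Q"]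
      by simp
  qed (use that in simp)
  show ?thesis
    unfolding derivation_def using sub mono by simp
qed

lemmas deriv_iter_closed = derivation_closed[OF derivation_iter]
  and deriv_iter_subset = derivation_subset[OF derivation_iter]
  and deriv_iter_mono = derivation_mono[OF derivation_iter]

text \<open>This is what makes an iterate depend on the value of a tree and not on its
  shape.\<close>

lemma deriv_iter_antimono:
  assumes "derivation d" "closed P" "cord_le a b"
  shows "deriv_iter d b P \<subseteq> deriv_iter d a P"
  using assms(3)
proof (induction rule: cord_le.induct)
  case (zero y)
  then show ?case
    using deriv_iter_subset[OF assms(1,2)] by simp
next
  case (succ x y)
  then show ?case
    using derivation_mono[OF assms(1)] deriv_iter_closed[OF assms(1,2)] by simp
next
  case (succ_right x y)
  then show ?case
    using derivation_subset[OF assms(1) deriv_iter_closed[OF assms(1,2)]] by fastforce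
qed auto

lemma deriv_iter_eq:
  assumes "derivation d" "closed P" "cord_eq a b"
  shows "deriv_iter d a P = deriv_iter d b P"
  using deriv_iter_antimono[OF assms(1,2)] assms(3) unfolding cord_eq_def by (simp add: subset_antisym)

lemma deriv_iter_zero:
  assumes "derivation d" "closed P" "cord_le a OZero"
  shows "deriv_iter d a P = P"
  using deriv_iter_eq[OF assms(1,2), of a OZero] assms(3) by (simp add: cord_eq_def cord_le.zero)

lemma deriv_iter_sup:
  assumes "derivation d" "closed P" "cord_eq a (OLim (\<lambda>n. OSucc (s n)))"
  shows "deriv_iter d a P = (\<Inter>n. d (deriv_iter d (s n) P))"
  using deriv_iter_eq[OF assms] by simp

lemma deriv_iter_le:
  assumes d: "derivation d" and d': "derivation d'" and "closed P" "closed Q" "P \<subseteq> Q"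
    and le: "\<And>R. closed R \<Longrightarrow> d R \<subseteq> d' R"
  shows "deriv_iter d a P \<subseteq> deriv_iter d' a Q"
proof -
  let ?R = "\<lambda>A B. closed A \<and> closed B \<and> A \<subseteq> B"
  have "?R (deriv_iter d a P) (deriv_iter d' a Q)"
  proof (rule deriv_iter_rel[where Rel = ?R])
    fix A B :: "'a set" assume AB: "?R A B"
    then have "d A \<subseteq> d' B"
      using order_trans[OF le derivation_mono[OF d']] by simp
    then show "?R (d A) (d' B)"
      using AB derivation_closed[OF d] derivation_closed[OF d'] by simp
  next
    fix A B :: "nat \<Rightarrow> 'a set" assume AB: "\<And>n. ?R (A n) (B n)"
    then have "(\<Inter>n. A n) \<subseteq> (\<Inter>n. B n)"
      by (intro INF_mono) auto
    then show "?R (\<Inter>n. A n) (\<Inter>n. B n)"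
      using AB by (simp add: closed_INT)
  qed (use assms(3-5) in simp)
  then show ?thesis by blast
qed

lemma deriv_iter_add: "deriv_iter d (cord_add a b) P = deriv_iter d b (deriv_iter d a P)"
  by (induction b) auto

lemma deriv_iter_mul: "deriv_iter d (cord_mul a b) P = deriv_iter (deriv_iter d a) b P"
  by (induction b) (auto simp: deriv_iter_add)

lemma deriv_iter_of_nat: "deriv_iter d (cord_of_nat n) P = (d ^^ n) P"
  by (induction n) auto

lemma deriv_iter_wexp_Suc:
  "deriv_iter d (cord_wexp (OSucc a)) P = (\<Inter>n. (deriv_iter d (cord_wexp a) ^^ n) P)"
  by (simp add: cord_mul_nat_eq deriv_iter_mul deriv_iter_of_nat)

text \<open>At a successor, omega^(b + 1) unfolds into finite powers of the derivation, so the
  induction hypothesis is used as an equality of functions.\<close>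

lemma deriv_iter_wexp_add:
  "deriv_iter d (cord_wexp (cord_add a b)) P = deriv_iter (deriv_iter d (cord_wexp a)) (cord_wexp b) P"
proof (induction b arbitrary: P)
  case (OSucc b)
  then have "deriv_iter d (cord_wexp (cord_add a b)) = deriv_iter (deriv_iter d (cord_wexp a)) (cord_wexp b)"
    by blast
  then show ?case
    by (simp only: cord_add.simps deriv_iter_wexp_Suc)
qed auto

section \<open>Additivity, and iteration of an inclusion in a union\<close>

lemma derivation_funpow: "derivation d \<Longrightarrow> derivation (d ^^ n)"
  using derivation_iter[of d "cord_of_nat n"] by (simp add: deriv_iter_of_nat[abs_def])

text \<open>Only one inclusion is stated; the opposite one is monotonicity.\<close>

definition additive :: "('a::topological_space set \<Rightarrow> 'a set) \<Rightarrow> bool" where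
  "additive d \<longleftrightarrow> (\<forall>P Q. closed P \<longrightarrow> closed Q \<longrightarrow> d (P \<union> Q) \<subseteq> d P \<union> d Q)"

lemma additive_iter:
  assumes d: "derivation d" and "additive d"
  shows "additive (deriv_iter d a)"
  unfolding additive_def
proof (intro allI impI)
  fix P Q :: "'a set" assume PQ: "closed P" "closed Q"
  show "deriv_iter d a (P \<union> Q) \<subseteq> deriv_iter d a P \<union> deriv_iter d a Q"
  proof (induction a)
    case (OSucc a)
    have "d (deriv_iter d a (P \<union> Q)) \<subseteq> d (deriv_iter d a P \<union> deriv_iter d a Q)"
      using derivation_mono[OF d _ _ OSucc] deriv_iter_closed[OF d] PQ by (simp add: closed_Un)
    also have "\<dots> \<subseteq> d (deriv_iter d a P) \<union> d (deriv_iter d a Q)"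
      using assms(2) PQ deriv_iter_closed[OF d] unfolding additive_def by blast
    finally show ?case by simp
  next
    case (OLim f)
    show ?case
    proof (rule ccontr)
      assume "\<not> ?thesis"
      then obtain x m n where x: "x \<in> deriv_iter d (OLim f) (P \<union> Q)"
        "x \<notin> deriv_iter d (f m) P" "x \<notin> deriv_iter d (f n) Q"
        unfolding deriv_iter.simps by blast
      \<comment> \<open>Iterates decrease, so the larger of the two stages excludes \<open>x\<close>
        on both sides.\<close>
      have "\<exists>k. x \<notin> deriv_iter d (f k) P \<and> x \<notin> deriv_iter d (f k) Q"
        using cord_le_linear[of "f m" "f n"] deriv_iter_antimono[OF d PQ(1)]
          deriv_iter_antimono[OF d PQ(2)] x(2,3) by blast
      then show False
        using x(1) OLim by fastforce
    qed
  qed auto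
qed

lemma additive_Union:
  assumes "derivation d" "additive d" "finite I" "\<And>i. i \<in> I \<Longrightarrow> closed (S i)"
  shows "d (\<Union>i\<in>I. S i) \<subseteq> (\<Union>i\<in>I. d (S i))"
  using assms(3,4)
proof (induction I)
  case empty
  then show ?case
    using derivation_subset[OF assms(1), of "{}"] by simp
next
  case (insert i I)
  have "d (S i \<union> (\<Union>i\<in>I. S i)) \<subseteq> d (S i) \<union> d (\<Union>i\<in>I. S i)"
    using assms(2) insert.prems insert.hyps(1) unfolding additive_def by (simp add: closed_UN)
  moreover have "d (\<Union>i\<in>I. S i) \<subseteq> (\<Union>i\<in>I. d (S i))"
    using insert.IH insert.prems by simp
  ultimately show ?case
    by auto
qed

text \<open>Pigeonhole: each application of \<open>E\<close> is charged to \<open>A\<close>,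
  \<open>B\<close> or \<open>C\<close>, and after i + j + k of them one of the three quotas is
  filled. Additivity of \<open>E\<close> lets the three parts of the first step be followed
  separately, each with its own quota lowered by one.\<close>

lemma funpow_union_subset:
  assumes E: "derivation E" "additive E"
    and A: "derivation A" and B: "derivation B" and C: "derivation C"
    and le: "\<And>P. closed P \<Longrightarrow> E P \<subseteq> A P \<union> B P \<union> C P"
    and "closed P"
  shows "(E ^^ (i + j + k)) P \<subseteq> (A ^^ i) P \<union> (B ^^ j) P \<union> (C ^^ k) P"
  using \<open>closed P\<close>
proof (induction "i + j + k" arbitrary: i j k P)
  case 0
  then show ?case by simp
next
  case (Suc N)
  have En: "derivation (E ^^ N)" and Ea: "additive (E ^^ N)"
    using derivation_funpow[OF E(1)] additive_iter[OF E, of "cord_of_nat N"]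
    by (auto simp: deriv_iter_of_nat[abs_def])
  show ?case
  proof (cases "i = 0 \<or> j = 0 \<or> k = 0")
    case True
    then show ?thesis
      using derivation_subset[OF derivation_funpow[OF E(1)] Suc.prems, of "i + j + k"] by auto
  next
    case False
    then obtain i' j' k' where s: "i = Suc i'" "j = Suc j'" "k = Suc k'"
      by (metis not0_implies_Suc)
    note cl = derivation_closed[OF A Suc.prems] derivation_closed[OF B Suc.prems]
      derivation_closed[OF C Suc.prems]
    have mono: "(D ^^ n) (D' P) \<subseteq> (D ^^ n) P" if "derivation D" "derivation D'" for n D D'
      by (rule derivation_mono[OF derivation_funpow[OF that(1)] derivation_closed[OF that(2) Suc.prems]
            Suc.prems derivation_subset[OF that(2) Suc.prems]])
    have N: "N = i' + j + k" "N = i + j' + k" "N = i + j + k'"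
      using Suc.hyps(2) s by auto
    have "(E ^^ (i + j + k)) P = (E ^^ N) (E P)"
      using Suc.hyps(2) by (metis funpow_Suc_right comp_apply)
    also have "\<dots> \<subseteq> (E ^^ N) (A P \<union> B P \<union> C P)"
      using derivation_mono[OF En _ _ le] derivation_closed[OF E(1)] cl Suc.prems by auto
    also have "\<dots> \<subseteq> (E ^^ N) (A P) \<union> (E ^^ N) (B P) \<union> (E ^^ N) (C P)"
    proof -
      have "(E ^^ N) (A P \<union> B P \<union> C P) \<subseteq> (E ^^ N) (A P \<union> B P) \<union> (E ^^ N) (C P)"
        "(E ^^ N) (A P \<union> B P) \<subseteq> (E ^^ N) (A P) \<union> (E ^^ N) (B P)"
        using Ea cl unfolding additive_def by auto
      then show ?thesis by blast
    qed
    also have "\<dots> \<subseteq> (A ^^ i) P \<union> (B ^^ j) P \<union> (C ^^ k) P"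
    proof (intro Un_least)
      have "(E ^^ N) (A P) \<subseteq> (A ^^ i') (A P) \<union> (B ^^ j) (A P) \<union> (C ^^ k) (A P)"
        using Suc.hyps(1)[OF N(1) cl(1)] N(1) by simp
      then show "(E ^^ N) (A P) \<subseteq> (A ^^ i) P \<union> (B ^^ j) P \<union> (C ^^ k) P"
        using mono[OF B A] mono[OF C A] by (simp only: s(1) funpow_Suc_right comp_apply) blast
      have "(E ^^ N) (B P) \<subseteq> (A ^^ i) (B P) \<union> (B ^^ j') (B P) \<union> (C ^^ k) (B P)"
        using Suc.hyps(1)[OF N(2) cl(2)] N(2) by simp
      then show "(E ^^ N) (B P) \<subseteq> (A ^^ i) P \<union> (B ^^ j) P \<union> (C ^^ k) P"
        using mono[OF A B] mono[OF C B] by (simp only: s(2) funpow_Suc_right comp_apply) blast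
      have "(E ^^ N) (C P) \<subseteq> (A ^^ i) (C P) \<union> (B ^^ j) (C P) \<union> (C ^^ k') (C P)"
        using Suc.hyps(1)[OF N(3) cl(3)] N(3) by simp
      then show "(E ^^ N) (C P) \<subseteq> (A ^^ i) P \<union> (B ^^ j) P \<union> (C ^^ k) P"
        using mono[OF A C] mono[OF B C] by (simp only: s(3) funpow_Suc_right comp_apply) blast
    qed
    finally show ?thesis .
  qed
qed

text \<open>Induction on the exponent: the inclusion at omega^a, being valid for all closed sets, is
  a hypothesis of the same shape for the omega^a-fold iterates, and the finite count applies to
  these. At a limit the largest of three stages is taken.\<close>

lemma deriv_iter_wexp_union_subset:
  assumes E: "derivation E" "additive E"
    and A: "derivation A" and B: "derivation B" and C: "derivation C"
    and le: "\<And>P. closed P \<Longrightarrow> E P \<subseteq> A P \<union> B P \<union> C P"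
    and "closed P"
  shows "deriv_iter E (cord_wexp a) P \<subseteq>
    deriv_iter A (cord_wexp a) P \<union> deriv_iter B (cord_wexp a) P \<union> deriv_iter C (cord_wexp a) P"
  using \<open>closed P\<close>
proof (induction a arbitrary: P)
  case OZero
  then show ?case using le by simp
next
  case (OSucc a)
  show ?case
  proof (rule ccontr)
    assume "\<not> ?thesis"
    then obtain x i j k where x: "x \<in> deriv_iter E (cord_wexp (OSucc a)) P"
      "x \<notin> (deriv_iter A (cord_wexp a) ^^ i) P" "x \<notin> (deriv_iter B (cord_wexp a) ^^ j) P"
      "x \<notin> (deriv_iter C (cord_wexp a) ^^ k) P"
      unfolding deriv_iter_wexp_Suc by blast
    moreover have "x \<in> (deriv_iter E (cord_wexp a) ^^ (i + j + k)) P"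
      using x(1) unfolding deriv_iter_wexp_Suc by blast
    ultimately show False
      using subsetD[OF funpow_union_subset[OF derivation_iter[OF E(1)] additive_iter[OF E]
          derivation_iter[OF A] derivation_iter[OF B] derivation_iter[OF C] OSucc.IH OSucc.prems,
          where i = i and j = j and k = k], of x]
      by blast
  qed
next
  case (OLim f)
  show ?case
  proof (rule ccontr)
    assume "\<not> ?thesis"
    then obtain x i j k where x: "x \<in> deriv_iter E (cord_wexp (OLim f)) P"
      "x \<notin> deriv_iter A (cord_wexp (f i)) P" "x \<notin> deriv_iter B (cord_wexp (f j)) P"
      "x \<notin> deriv_iter C (cord_wexp (f k)) P"
      unfolding cord_wexp.simps deriv_iter.simps by blast
    obtain l where "cord_le (f i) (f l)" "cord_le (f j) (f l)"
      using cord_le_linear cord_le_refl by metis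
    then obtain m where "cord_le (f i) (f m)" "cord_le (f j) (f m)" "cord_le (f k) (f m)"
      using cord_le_linear[of "f l" "f k"] cord_le_refl cord_le_trans by metis
    then have "x \<notin> deriv_iter A (cord_wexp (f m)) P \<and> x \<notin> deriv_iter B (cord_wexp (f m)) P \<and>
      x \<notin> deriv_iter C (cord_wexp (f m)) P"
      using x(2-) contra_subsetD[OF deriv_iter_antimono[OF A OLim.prems cord_wexp_mono], of "f i" "f m"]
        contra_subsetD[OF deriv_iter_antimono[OF B OLim.prems cord_wexp_mono], of "f j" "f m"]
        contra_subsetD[OF deriv_iter_antimono[OF C OLim.prems cord_wexp_mono], of "f k" "f m"] by simp
    moreover have "x \<in> deriv_iter E (cord_wexp (f m)) P"
      using x(1) by simp
    ultimately show False
      using subsetD[OF OLim.IH[of "f m", OF _ OLim.prems], of x] by simp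
  qed
qed

section \<open>The concrete derivations: \<open>acc\<close>, \<open>hM\<close>,
  \<open>delta\<close>, \<open>osc_der\<close> and \<open>Omega\<close>\<close>

lemma acc_mono: "A \<subseteq> B \<Longrightarrow> acc A \<subseteq> acc B"
  by (auto simp: acc_def intro: islimpt_subset)

lemma acc_subset_closed: "closed P \<Longrightarrow> A \<subseteq> P \<Longrightarrow> acc A \<subseteq> P"
  using acc_mono[of A P] by (auto simp: acc_def closed_limpt)

lemma derivation_acc_Int: "derivation (\<lambda>P. acc (P \<inter> (Q::'a::metric_space set)))"
  unfolding derivation_def
proof (intro conjI allI impI)
  fix P :: "'a set" assume P: "closed P"
  show "closed (acc (P \<inter> Q))"
    unfolding acc_def by (rule closed_limpts)
  show "acc (P \<inter> Q) \<subseteq> P"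
    using P by (intro acc_subset_closed) auto
next
  fix P R :: "'a set" assume "P \<subseteq> R"
  then show "acc (P \<inter> Q) \<subseteq> acc (R \<inter> Q)"
    by (intro acc_mono) auto
qed

lemma derivation_acc: "derivation (acc :: 'a::metric_space set \<Rightarrow> 'a set)"
  using derivation_acc_Int[of UNIV] by simp

lemma derivation_hM: "derivation (hM (h :: 'a::metric_space \<Rightarrow> real) M)"
  using derivation_acc_Int[of "{x. \<bar>h x\<bar> > M}"] by (simp add: hM_def[abs_def])

lemma additive_acc: "additive (acc :: 'a::metric_space set \<Rightarrow> 'a set)"
  by (auto simp: additive_def acc_def islimpt_Un)

lemma in_O_setE:
  assumes "x \<in> O_set f e P" "open U" "x \<in> U"
  obtains y where "y \<in> P" "y \<in> U" "\<bar>f y - f x\<bar> \<ge> e"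
  using assms(1)[unfolded O_set_def mem_Collect_eq, THEN conjunct2, THEN spec, of U] assms(2,3)
  by blast

lemma in_O_setI:
  assumes "x \<in> P"
    and "\<And>U. open U \<Longrightarrow> x \<in> U \<Longrightarrow> \<exists>y\<in>U \<inter> P. \<bar>f y - f x\<bar> \<ge> e"
  shows "x \<in> O_set f e P"
  unfolding O_set_def mem_Collect_eq using assms by (intro conjI allI impI) simp_all

lemma not_in_O_setE:
  assumes "x \<notin> O_set h e P" "x \<in> P"
  obtains U where "open U" "x \<in> U" "\<forall>y\<in>U \<inter> P. \<bar>h y - h x\<bar> < e"
proof -
  have "\<exists>U. (open U \<and> x \<in> U) \<and> \<not> (\<exists>y\<in>U \<inter> P. \<bar>h y - h x\<bar> \<ge> e)"
    using assms by (simp only: O_set_def mem_Collect_eq not_all not_imp simp_thms)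
  then obtain U where U: "open U" "x \<in> U" "\<not> (\<exists>y\<in>U \<inter> P. \<bar>h y - h x\<bar> \<ge> e)"
    by (elim exE conjE)
  then have "\<forall>y\<in>U \<inter> P. \<bar>h y - h x\<bar> < e"
    using not_le by blast
  with U(1,2) show thesis
    by (rule that)
qed

lemma O_set_subset: "O_set f e P \<subseteq> P"
  unfolding O_set_def by (rule Collect_restrict)

lemma O_set_mono:
  assumes "P \<subseteq> R" shows "O_set h e P \<subseteq> O_set h e R"
proof
  fix x assume x: "x \<in> O_set h e P"
  show "x \<in> O_set h e R"
  proof (rule in_O_setI)
    show "x \<in> R" using x O_set_subset assms by (meson subsetD)
    fix U assume "open U" "x \<in> U"
    with x obtain y where "y \<in> P" "y \<in> U" "\<bar>h y - h x\<bar> \<ge> e"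
      by (rule in_O_setE)
    then show "\<exists>y\<in>U \<inter> R. e \<le> \<bar>h y - h x\<bar>"
      using assms by blast
  qed
qed

lemma in_osc_derE:
  assumes "x \<in> osc_der f e P" "open U" "x \<in> U"
  obtains x1 x2 where "x1 \<in> P" "x1 \<in> U" "x2 \<in> P" "x2 \<in> U" "\<bar>f x1 - f x2\<bar> \<ge> e"
  using assms(1)[unfolded osc_der_def mem_Collect_eq, THEN conjunct2, THEN spec, of U] assms(2,3)
  by blast

lemma in_osc_derI:
  assumes "x \<in> P"
    and "\<And>U. open U \<Longrightarrow> x \<in> U \<Longrightarrow> \<exists>x1\<in>P \<inter> U. \<exists>x2\<in>P \<inter> U. \<bar>f x1 - f x2\<bar> \<ge> e"
  shows "x \<in> osc_der f e P"
  unfolding osc_der_def mem_Collect_eq using assms by (intro conjI allI impI) simp_all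

lemma not_in_osc_derE:
  assumes "x \<notin> osc_der f e P" "x \<in> P"
  obtains U where "open U" "x \<in> U" "\<forall>y\<in>P \<inter> U. \<forall>z\<in>P \<inter> U. \<bar>f y - f z\<bar> < e"
proof -
  have "\<exists>U. (open U \<and> x \<in> U) \<and> \<not> (\<exists>y\<in>P \<inter> U. \<exists>z\<in>P \<inter> U. \<bar>f y - f z\<bar> \<ge> e)"
    using assms by (simp only: osc_der_def mem_Collect_eq not_all not_imp simp_thms)
  then obtain U where U: "open U" "x \<in> U" "\<not> (\<exists>y\<in>P \<inter> U. \<exists>z\<in>P \<inter> U. \<bar>f y - f z\<bar> \<ge> e)"
    by (elim exE conjE)
  then have "\<forall>y\<in>P \<inter> U. \<forall>z\<in>P \<inter> U. \<bar>f y - f z\<bar> < e"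
    using not_le by blast
  with U(1,2) show thesis
    by (rule that)
qed

lemma osc_der_subset: "osc_der f e P \<subseteq> P"
  unfolding osc_der_def by (rule Collect_restrict)

lemma osc_der_mono:
  assumes "P \<subseteq> R" shows "osc_der f e P \<subseteq> osc_der f e R"
proof
  fix x assume x: "x \<in> osc_der f e P"
  show "x \<in> osc_der f e R"
  proof (rule in_osc_derI)
    show "x \<in> R" using x osc_der_subset assms by (meson subsetD)
    fix U assume "open U" "x \<in> U"
    with x obtain x1 x2 where "x1 \<in> P" "x1 \<in> U" "x2 \<in> P" "x2 \<in> U" "\<bar>f x1 - f x2\<bar> \<ge> e"
      by (rule in_osc_derE)
    then show "\<exists>x1\<in>R \<inter> U. \<exists>x2\<in>R \<inter> U. e \<le> \<bar>f x1 - f x2\<bar>"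
      using assms by blast
  qed
qed

lemma derivation_delta: "derivation (delta (h :: 'a::topological_space \<Rightarrow> real) e)"
  unfolding derivation_def delta_def
proof (intro conjI allI impI)
  fix P :: "'a set" assume P: "closed P"
  show "closure (O_set h e P) \<subseteq> P"
    using O_set_subset P by (rule closure_minimal)
next
  fix P R :: "'a set" assume "P \<subseteq> R"
  then show "closure (O_set h e P) \<subseteq> closure (O_set h e R)"
    by (intro closure_mono O_set_mono)
qed auto

text \<open>Oscillation is measured against the centre x: if U controls it on P and V on Q, then the
  intersection of U and V controls it on the union. If x lies outside one of the sets, closedness
  gives a neighbourhood that misses that set.\<close>

lemma additive_delta: "additive (delta (h :: 'a::topological_space \<Rightarrow> real) e)"
  unfolding additive_def delta_def
proof (intro allI impI)
  fix P Q :: "'a set" assume P: "closed P" and Q: "closed Q"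
  have "O_set h e (P \<union> Q) \<subseteq> O_set h e P \<union> O_set h e Q"
  proof
    fix x assume x: "x \<in> O_set h e (P \<union> Q)"
    have *: "x \<in> O_set h e R \<or> (\<exists>U. open U \<and> x \<in> U \<and> (\<forall>y\<in>U \<inter> R. \<bar>h y - h x\<bar> < e))"
      if "closed R" for R
    proof (cases "x \<in> R")
      case True
      then show ?thesis
        by (cases "x \<in> O_set h e R") (blast, elim not_in_O_setE, blast+)
    next
      case False
      then show ?thesis
        using that by (intro disjI2 exI[of _ "- R"]) auto
    qed
    show "x \<in> O_set h e P \<union> O_set h e Q"
    proof (rule ccontr)
      assume "x \<notin> O_set h e P \<union> O_set h e Q"
      then obtain U V where UV: "open U" "x \<in> U" "\<forall>y\<in>U \<inter> P. \<bar>h y - h x\<bar> < e"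
        "open V" "x \<in> V" "\<forall>y\<in>V \<inter> Q. \<bar>h y - h x\<bar> < e"
        using *[OF P] *[OF Q] by blast
      then have "open (U \<inter> V) \<and> x \<in> U \<inter> V" by auto
      then obtain y where "y \<in> U \<inter> V" "y \<in> P \<union> Q" "\<bar>h y - h x\<bar> \<ge> e"
        using in_O_setE[OF x, of "U \<inter> V"] by metis
      then show False
        using UV by force
    qed
  qed
  then show "closure (O_set h e (P \<union> Q)) \<subseteq> closure (O_set h e P) \<union> closure (O_set h e Q)"
    by (metis closure_Un closure_mono)
qed

lemma derivation_osc_der: "derivation (osc_der (f :: 'a::topological_space \<Rightarrow> real) e)"
  unfolding derivation_def
proof (intro conjI allI impI)
  fix P :: "'a set" assume P: "closed P"
  have "\<exists>T. open T \<and> x \<in> T \<and> T \<subseteq> - osc_der f e P" if x: "x \<in> - osc_der f e P" for x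
  proof (cases "x \<in> P")
    case True
    with x obtain U where U: "open U" "x \<in> U" "\<forall>y\<in>P \<inter> U. \<forall>z\<in>P \<inter> U. \<bar>f y - f z\<bar> < e"
      using not_in_osc_derE by (metis ComplD)
    have "y \<notin> osc_der f e P" if "y \<in> U" for y
      using in_osc_derE[of y f e P U] U that by (metis IntI not_le)
    then show ?thesis
      using U by blast
  next
    case False
    then show ?thesis
      using P osc_der_subset[of f e P] by (intro exI[of _ "- P"]) auto
  qed
  then show "closed (osc_der f e P)"
    unfolding closed_def by (subst open_subopen) simp
qed (simp_all add: osc_der_subset osc_der_mono)

lemma derivation_Omega: "derivation (Omega (h :: 'a::metric_space \<Rightarrow> real) xis)"
  unfolding derivation_def
proof (intro conjI allI impI)
  fix P :: "'a set" assume P: "closed P"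
  show "closed (Omega h xis P)"
    by (auto simp: Omega_def acc_def intro!: closed_INT closed_limpts)
  have "deriv_iter (delta h eta) (xis n) P \<subseteq> P" for eta n
    by (rule deriv_iter_subset[OF derivation_delta P])
  then have "(\<Union>eta\<in>{eta. eta > 0}. deriv_iter (delta h eta) (xis n) P) \<subseteq> P" for n
    by blast
  then have "acc (\<Union>eta\<in>{eta. eta > 0}. deriv_iter (delta h eta) (xis n) P) \<subseteq> P" for n
    using P by (intro acc_subset_closed)
  then show "Omega h xis P \<subseteq> P"
    unfolding Omega_def by blast
next
  fix P Q :: "'a set" assume PQ: "closed P" "closed Q" "P \<subseteq> Q"
  have "(\<Union>eta\<in>{eta. eta > 0}. deriv_iter (delta h eta) (xis n) P) \<subseteq>
      (\<Union>eta\<in>{eta. eta > 0}. deriv_iter (delta h eta) (xis n) Q)" for n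
    using deriv_iter_mono[OF derivation_delta PQ] by blast
  then show "Omega h xis P \<subseteq> Omega h xis Q"
    unfolding Omega_def using acc_mono by (intro INF_mono) blast
qed

text \<open>Two values at least e apart cannot both be closer than e/2 to f x. This is the only loss
  in passing between the two notions of oscillation.\<close>

lemma osc_der_subset_O_set: "osc_der f e P \<subseteq> O_set f (e/2) P"
proof
  fix x assume x: "x \<in> osc_der f e P"
  show "x \<in> O_set f (e/2) P"
  proof (rule in_O_setI)
    show "x \<in> P" using x osc_der_subset by (rule rev_subsetD)
    fix U assume "open U" "x \<in> U"
    with x obtain x1 x2 where *: "x1 \<in> P" "x1 \<in> U" "x2 \<in> P" "x2 \<in> U" "\<bar>f x1 - f x2\<bar> \<ge> e"
      by (rule in_osc_derE)
    then have "\<bar>f x1 - f x\<bar> \<ge> e/2 \<or> \<bar>f x2 - f x\<bar> \<ge> e/2"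
      by linarith
    with * show "\<exists>y\<in>U \<inter> P. e/2 \<le> \<bar>f y - f x\<bar>" by blast
  qed
qed

lemma osc_der_subset_delta: "osc_der f e P \<subseteq> delta f (e/2) P"
  unfolding delta_def by (rule order_trans[OF osc_der_subset_O_set closure_subset])

lemma O_set_subset_osc_der: "O_set f e P \<subseteq> osc_der f e P"
proof
  fix x assume x: "x \<in> O_set f e P"
  have "x \<in> P" using x O_set_subset by (rule rev_subsetD)
  then show "x \<in> osc_der f e P"
  proof (rule in_osc_derI)
    fix U assume "open U" "x \<in> U"
    with x obtain y where "y \<in> P" "y \<in> U" "\<bar>f y - f x\<bar> \<ge> e"
      by (rule in_O_setE)
    then show "\<exists>x1\<in>P \<inter> U. \<exists>x2\<in>P \<inter> U. e \<le> \<bar>f x1 - f x2\<bar>"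
      using \<open>x \<in> P\<close> \<open>x \<in> U\<close> by blast
  qed
qed

lemma delta_subset_osc_der:
  assumes "closed P" shows "delta f e P \<subseteq> osc_der f e P"
  unfolding delta_def
  by (rule closure_minimal[OF O_set_subset_osc_der derivation_closed[OF derivation_osc_der assms]])

lemma osc_der_subset_acc:
  assumes "e > 0" shows "osc_der f e P \<subseteq> acc P"
proof
  fix x assume x: "x \<in> osc_der f e P"
  have "x islimpt P"
  proof (rule islimptI)
    fix T assume "x \<in> T" "open T"
    then obtain x1 x2 where *: "x1 \<in> P" "x1 \<in> T" "x2 \<in> P" "x2 \<in> T" "\<bar>f x1 - f x2\<bar> \<ge> e"
      using in_osc_derE[OF x] by metis
    then have "x1 \<noteq> x2"
      using assms by auto
    then show "\<exists>y\<in>P. y \<in> T \<and> y \<noteq> x"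
      using * by metis
  qed
  then show "x \<in> acc P" by (simp add: acc_def)
qed

lemma osc_der_const_empty:
  assumes "e > 0" "\<And>p. p \<in> P \<Longrightarrow> f p = v" shows "osc_der f e P = {}"
proof -
  have "x \<notin> osc_der f e P" for x
    using in_osc_derE[of x f e P UNIV] assms by (metis UNIV_I abs_zero diff_self not_le open_UNIV)
  then show ?thesis by blast
qed

lemma acc_singleton [simp]: "acc {x::'a::metric_space} = {}"
  by (auto simp: acc_def islimpt_finite)

lemma osc_rank_le_iff:
  "osc_rank_le f g \<longleftrightarrow> (\<forall>e>0. deriv_iter (osc_der f e) g UNIV = {})"
proof -
  have "(\<exists>a. cord_le a g \<and> deriv_iter (osc_der f e) a UNIV = {}) \<longleftrightarrow> deriv_iter (osc_der f e) g UNIV = {}" for e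
    using deriv_iter_antimono[OF derivation_osc_der closed_UNIV, of _ g f e] cord_le_refl[of g] by blast
  then show ?thesis
    unfolding osc_rank_le_def by simp
qed

section \<open>Functions of countable oscillation rank are of Baire class one\<close>

text \<open>In a metric space these are the sets that are both F-sigma and G-delta. Asking for
  eventual equality instead of convergence makes the formulas built from these functions exact from
  some index on.\<close>

definition approx_indicator :: "'a::metric_space set \<Rightarrow> bool" where
  "approx_indicator S \<longleftrightarrow> (\<exists>\<phi>::nat \<Rightarrow> 'a \<Rightarrow> real. (\<forall>k. continuous_on UNIV (\<phi> k)) \<and>
     (\<forall>x. \<forall>\<^sub>F k in sequentially. \<phi> k x = indicator S x))"

lemma approx_indicator_closed:
  fixes S :: "'a::metric_space set"
  assumes "closed S" shows "approx_indicator S"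
proof (cases "S = {}")
  case True
  then show ?thesis
    unfolding approx_indicator_def by (intro exI[of _ "\<lambda>_ _. 0"]) simp
next
  case False
  let ?\<phi> = "\<lambda>(k::nat) x. max 0 (1 - real k * infdist x S)"
  have "\<forall>\<^sub>F k in sequentially. ?\<phi> k x = indicator S x" for x
  proof (cases "x \<in> S")
    case False
    with \<open>S \<noteq> {}\<close> assms have pos: "infdist x S > 0"
      by (simp add: infdist_pos_not_in_closed)
    have "\<forall>\<^sub>F k in sequentially. real k \<ge> 1 / infdist x S"
      using filterlim_real_sequentially by (simp add: filterlim_at_top)
    then show ?thesis
      by eventually_elim (use False pos in \<open>simp add: field_simps\<close>)
  qed simp
  moreover have "continuous_on UNIV (?\<phi> k)" for k
    by (intro continuous_intros)
  ultimately show ?thesis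
    unfolding approx_indicator_def by (intro exI[of _ ?\<phi>]) simp
qed

lemma approx_indicator_Compl:
  assumes "approx_indicator S" shows "approx_indicator (- S)"
proof -
  obtain \<phi> :: "nat \<Rightarrow> 'a \<Rightarrow> real" where \<phi>: "\<And>k. continuous_on UNIV (\<phi> k)"
      "\<And>x. \<forall>\<^sub>F k in sequentially. \<phi> k x = indicator S x"
    using assms unfolding approx_indicator_def by auto
  have "\<forall>\<^sub>F k in sequentially. 1 - \<phi> k x = indicator (- S) x" for x
    using \<phi>(2)[of x] by eventually_elim (auto simp: indicator_def)
  then show ?thesis
    unfolding approx_indicator_def
    by (intro exI[of _ "\<lambda>k x. 1 - \<phi> k x"]) (auto intro!: continuous_intros \<phi>)
qed

lemma approx_indicator_Int:
  assumes "approx_indicator S" "approx_indicator T" shows "approx_indicator (S \<inter> T)"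
proof -
  obtain \<phi> :: "nat \<Rightarrow> 'a \<Rightarrow> real" where \<phi>: "\<And>k. continuous_on UNIV (\<phi> k)"
      "\<And>x. \<forall>\<^sub>F k in sequentially. \<phi> k x = indicator S x"
    using assms(1) unfolding approx_indicator_def by auto
  obtain \<psi> :: "nat \<Rightarrow> 'a \<Rightarrow> real" where \<psi>: "\<And>k. continuous_on UNIV (\<psi> k)"
      "\<And>x. \<forall>\<^sub>F k in sequentially. \<psi> k x = indicator T x"
    using assms(2) unfolding approx_indicator_def by auto
  have "\<forall>\<^sub>F k in sequentially. \<phi> k x * \<psi> k x = indicator (S \<inter> T) x" for x
    using \<phi>(2)[of x] \<psi>(2)[of x] by eventually_elim (auto simp: indicator_def)
  then show ?thesis
    unfolding approx_indicator_def
    by (intro exI[of _ "\<lambda>k x. \<phi> k x * \<psi> k x"]) (auto intro!: continuous_intros \<phi> \<psi>)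
qed

text \<open>Points of Q outside the derivative have neighbourhoods in which f oscillates by less
  than e on Q, and by Lindelof countably many of them suffice. Cut down to Q they are intersections
  of a closed and an open set.\<close>

lemma osc_der_complement_cover:
  fixes f :: "'a::{metric_space,second_countable_topology} \<Rightarrow> real"
  assumes "closed Q"
  shows "\<exists>\<C>. countable \<C> \<and> (\<forall>C\<in>\<C>. approx_indicator C \<and> (\<forall>x\<in>C. \<forall>y\<in>C. \<bar>f x - f y\<bar> < e)) \<and>
    Q \<subseteq> \<Union>\<C> \<union> osc_der f e Q"
proof -
  define F where "F = {U. open U \<and> (\<forall>y\<in>Q \<inter> U. \<forall>z\<in>Q \<inter> U. \<bar>f y - f z\<bar> < e)}"
  obtain F' where F': "F' \<subseteq> F" "countable F'" "\<Union>F' = \<Union>F"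
  proof (rule Lindelof)
    show "open U" if "U \<in> F" for U
      using that by (simp add: F_def)
  qed
  have "x \<in> \<Union>F" if x: "x \<in> Q" "x \<notin> osc_der f e Q" for x
  proof -
    obtain U where "open U" "x \<in> U" "\<forall>y\<in>Q \<inter> U. \<forall>z\<in>Q \<inter> U. \<bar>f y - f z\<bar> < e"
      using x(2,1) by (rule not_in_osc_derE)
    then have "U \<in> F"
      by (simp add: F_def)
    with \<open>x \<in> U\<close> show ?thesis by (rule UnionI[rotated])
  qed
  then have "Q \<subseteq> \<Union>F \<union> osc_der f e Q"
    by blast
  then have "Q \<subseteq> \<Union>((\<lambda>U. Q \<inter> U) ` F') \<union> osc_der f e Q"
    unfolding F'(3)[symmetric] by blast
  moreover have "approx_indicator (Q \<inter> U)" if "U \<in> F'" for U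
  proof -
    have "closed (- U)"
      using subsetD[OF F'(1) that] by (simp add: F_def closed_Compl)
    then have "approx_indicator (- (- U))"
      by (intro approx_indicator_Compl approx_indicator_closed)
    then show ?thesis
      using approx_indicator_Int[OF approx_indicator_closed[OF assms]] by simp
  qed
  moreover have "\<bar>f x - f y\<bar> < e" if "U \<in> F'" "x \<in> Q \<inter> U" "y \<in> Q \<inter> U" for U x y
    using subsetD[OF F'(1) that(1)] that(2,3) by (simp add: F_def)
  ultimately show ?thesis
    using F'(2) by (intro exI[of _ "(\<lambda>U. Q \<inter> U) ` F'"]) simp
qed

text \<open>The cover is countable because the ordinal is: every stage adds countably many pieces,
  and a point that leaves at a limit has left at an earlier stage.\<close>

lemma small_oscillation_cover:
  fixes f :: "'a::{metric_space,second_countable_topology} \<Rightarrow> real"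
  shows "\<exists>\<C>. countable \<C> \<and> (\<forall>C\<in>\<C>. approx_indicator C \<and> (\<forall>x\<in>C. \<forall>y\<in>C. \<bar>f x - f y\<bar> < e)) \<and>
    UNIV \<subseteq> \<Union>\<C> \<union> deriv_iter (osc_der f e) a UNIV"
proof (induction a)
  case OZero
  then show ?case by (intro exI[of _ "{}"]) simp
next
  case (OSucc a)
  then obtain \<C> where C: "countable \<C>"
    "\<forall>C\<in>\<C>. approx_indicator C \<and> (\<forall>x\<in>C. \<forall>y\<in>C. \<bar>f x - f y\<bar> < e)"
    "UNIV \<subseteq> \<Union>\<C> \<union> deriv_iter (osc_der f e) a UNIV"
    by (elim exE conjE)
  have "closed (deriv_iter (osc_der f e) a UNIV)"
    by (rule deriv_iter_closed[OF derivation_osc_der closed_UNIV])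
  from osc_der_complement_cover[OF this, of f e] obtain \<D> where D: "countable \<D>"
    "\<forall>C\<in>\<D>. approx_indicator C \<and> (\<forall>x\<in>C. \<forall>y\<in>C. \<bar>f x - f y\<bar> < e)"
    "deriv_iter (osc_der f e) a UNIV \<subseteq> \<Union>\<D> \<union> osc_der f e (deriv_iter (osc_der f e) a UNIV)"
    by (elim exE conjE)
  have "UNIV \<subseteq> \<Union>(\<C> \<union> \<D>) \<union> deriv_iter (osc_der f e) (OSucc a) UNIV"
    using C(3) D(3) unfolding deriv_iter.simps by blast
  moreover have "\<forall>C\<in>\<C> \<union> \<D>. approx_indicator C \<and> (\<forall>x\<in>C. \<forall>y\<in>C. \<bar>f x - f y\<bar> < e)"
    using C(2) D(2) by blast
  ultimately show ?case
    using C(1) D(1) by (intro exI[of _ "\<C> \<union> \<D>"]) simp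
next
  case (OLim g)
  have "\<forall>n. \<exists>\<C>. countable \<C> \<and>
      (\<forall>C\<in>\<C>. approx_indicator C \<and> (\<forall>x\<in>C. \<forall>y\<in>C. \<bar>f x - f y\<bar> < e)) \<and>
      UNIV \<subseteq> \<Union>\<C> \<union> deriv_iter (osc_der f e) (g n) UNIV"
    by (intro allI OLim rangeI)
  then obtain \<C> where "\<forall>n. countable (\<C> n) \<and>
      (\<forall>C\<in>\<C> n. approx_indicator C \<and> (\<forall>x\<in>C. \<forall>y\<in>C. \<bar>f x - f y\<bar> < e)) \<and>
      UNIV \<subseteq> \<Union>(\<C> n) \<union> deriv_iter (osc_der f e) (g n) UNIV"
    unfolding choice_iff by (elim exE)
  then have C: "\<And>n. countable (\<C> n)"
    "\<And>n. \<forall>C\<in>\<C> n. approx_indicator C \<and> (\<forall>x\<in>C. \<forall>y\<in>C. \<bar>f x - f y\<bar> < e)"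
    "\<And>n. UNIV \<subseteq> \<Union>(\<C> n) \<union> deriv_iter (osc_der f e) (g n) UNIV"
    by simp_all
  have "UNIV \<subseteq> \<Union>(\<Union>n. \<C> n) \<union> deriv_iter (osc_der f e) (OLim g) UNIV"
  proof
    fix x
    have "x \<in> \<Union>(\<C> n) \<or> x \<in> deriv_iter (osc_der f e) (g n) UNIV" for n
      using subsetD[OF C(3)[of n], of x] by simp
    then show "x \<in> \<Union>(\<Union>n. \<C> n) \<union> deriv_iter (osc_der f e) (OLim g) UNIV"
      by auto
  qed
  moreover have "\<forall>C\<in>(\<Union>n. \<C> n). approx_indicator C \<and> (\<forall>x\<in>C. \<forall>y\<in>C. \<bar>f x - f y\<bar> < e)"
    using C(2) by blast
  moreover have "countable (\<Union>n. \<C> n)"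
    using C(1) by simp
  ultimately show ?case
    by (intro exI[of _ "\<Union>n. \<C> n"] conjI)
qed

lemma small_oscillation_approx:
  fixes f :: "'a::{metric_space,second_countable_topology} \<Rightarrow> real"
  assumes "deriv_iter (osc_der f e) a UNIV = {}"
  shows "\<exists>(G::nat \<Rightarrow> 'a \<Rightarrow> real) g. (\<forall>k. continuous_on UNIV (G k)) \<and>
    (\<forall>x. (\<forall>\<^sub>F k in sequentially. G k x = g x) \<and> \<bar>f x - g x\<bar> < e)"
proof -
  obtain \<C> where C: "countable \<C>"
    "\<forall>C\<in>\<C>. approx_indicator C \<and> (\<forall>x\<in>C. \<forall>y\<in>C. \<bar>f x - f y\<bar> < e)" "UNIV \<subseteq> \<Union>\<C>"
    using small_oscillation_cover[of f e a] unfolding assms Un_empty_right by (elim exE conjE)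
  then have "\<C> \<noteq> {}" by auto
  define S where "S = from_nat_into \<C>"
  have S: "S i \<in> \<C>" for i
    unfolding S_def using \<open>\<C> \<noteq> {}\<close> by (rule from_nat_into)
  have ex: "\<exists>i. x \<in> S i" for x
    using C(1,3) unfolding S_def by (metis UNIV_I UnionE from_nat_into_surj subsetD)
  have "\<forall>i. \<exists>\<phi>::nat \<Rightarrow> 'a \<Rightarrow> real. (\<forall>k. continuous_on UNIV (\<phi> k)) \<and>
     (\<forall>x. \<forall>\<^sub>F k in sequentially. \<phi> k x = indicator (S i) x)"
    using S C(2) unfolding approx_indicator_def[symmetric] by blast
  then obtain \<phi> :: "nat \<Rightarrow> nat \<Rightarrow> 'a \<Rightarrow> real" where "\<forall>i. (\<forall>k. continuous_on UNIV (\<phi> i k)) \<and>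
     (\<forall>x. \<forall>\<^sub>F k in sequentially. \<phi> i k x = indicator (S i) x)"
    unfolding choice_iff by (elim exE)
  then have \<phi>: "\<And>i k. continuous_on UNIV (\<phi> i k)"
    "\<And>i x. \<forall>\<^sub>F k in sequentially. \<phi> i k x = indicator (S i) x"
    by simp_all
  define c where "c = (\<lambda>i. f (SOME x. x \<in> S i))"
  define N where "N = (\<lambda>x. LEAST i. x \<in> S i)"
  \<comment> \<open>The product switches piece i off on all earlier pieces. Once the functions up to
    index \<open>N x\<close> have settled at x, the factor 1 - \<phi> with index \<open>N x\<close>
    kills every later term, whatever the later functions still do.\<close>
  define G where "G = (\<lambda>k x. \<Sum>i<k. c i * \<phi> i k x * (\<Prod>j<i. 1 - \<phi> j k x))"
  have N: "x \<in> S (N x)" "\<And>j. j < N x \<Longrightarrow> x \<notin> S j" for x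
    unfolding N_def using ex[of x] by (auto intro: LeastI_ex dest: not_less_Least)
  have "\<forall>\<^sub>F k in sequentially. G k x = c (N x)" for x
  proof -
    have "\<forall>\<^sub>F k in sequentially. \<forall>j\<in>{..N x}. \<phi> j k x = indicator (S j) x"
      using \<phi>(2) by (intro eventually_ball_finite) auto
    moreover have "\<forall>\<^sub>F k in sequentially. N x < k"
      by (rule eventually_gt_at_top)
    ultimately show ?thesis
    proof eventually_elim
      case (elim k)
      have *: "\<phi> j k x = 0" if "j < N x" for j
        using elim(1) N(2)[OF that] that by auto
      have **: "\<phi> (N x) k x = 1"
        using elim(1) N(1)[of x] by auto
      have "c i * \<phi> i k x * (\<Prod>j<i. 1 - \<phi> j k x) = (if i = N x then c (N x) else 0)" for i
      proof -
        consider "i < N x" | "i = N x" | "i > N x" by linarith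
        then show ?thesis
        proof cases
          case 3
          then have "(\<Prod>j<i. 1 - \<phi> j k x) = 0"
            using ** by (intro prod_zero) auto
          then show ?thesis using 3 by simp
        qed (use * ** in auto)
      qed
      then show ?case
        using elim(2) by (simp add: G_def)
    qed
  qed
  moreover have "\<bar>f x - c (N x)\<bar> < e" for x
  proof -
    have "(SOME y. y \<in> S (N x)) \<in> S (N x)"
      using N(1)[of x] by (rule someI)
    then show ?thesis
      using C(2) S N(1)[of x] unfolding c_def by blast
  qed
  moreover have "continuous_on UNIV (G k)" for k
    unfolding G_def by (intro continuous_intros \<phi>)
  ultimately show ?thesis
    by (intro exI[of _ G] exI[of _ "\<lambda>x. c (N x)"]) simp
qed

text \<open>The approximants of level n agree with the n-th step function only from an index
  depending on n and x. Limiting each increment to 2 * 2^-n keeps everything above level n within 4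
  * 2^-n, even where it has not settled. Settled values are not altered, since consecutive step
  functions differ by less than 2^-n + 2^-(n+1).\<close>

primrec clamp_iter :: "(nat \<Rightarrow> 'a \<Rightarrow> real) \<Rightarrow> nat \<Rightarrow> 'a \<Rightarrow> real" where
  "clamp_iter G 0 = G 0"
| "clamp_iter G (Suc n) = (\<lambda>x. max (clamp_iter G n x - 2 * (1/2)^n)
     (min (clamp_iter G n x + 2 * (1/2)^n) (G (Suc n) x)))"

lemma continuous_on_clamp_iter:
  "(\<And>n. continuous_on A (G n)) \<Longrightarrow> continuous_on A (clamp_iter G n)"
  by (induction n) (auto intro!: continuous_intros)

lemma clamp_iter_step: "\<bar>clamp_iter G (Suc n) x - clamp_iter G n x\<bar> \<le> 2 * (1/2)^n"
  by (auto simp: max_def min_def)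

lemma clamp_iter_diff: "\<bar>clamp_iter G (n + m) x - clamp_iter G n x\<bar> \<le> 4 * (1/2)^n - 4 * (1/2)^(n + m)"
proof (induction m)
  case (Suc m)
  have "\<bar>clamp_iter G (Suc (n + m)) x - clamp_iter G n x\<bar> \<le>
      4 * (1/2)^n - 4 * (1/2)^(n + m) + 2 * (1/2)^(n + m)"
    using Suc clamp_iter_step[of G "n + m" x] by linarith
  then show ?case
    by (simp add: field_simps)
qed simp

lemma clamp_iter_eq:
  assumes "\<And>m. m < n \<Longrightarrow> \<bar>G (Suc m) x - G m x\<bar> \<le> 2 * (1/2)^m"
  shows "clamp_iter G n x = G n x"
  using assms
proof (induction n)
  case (Suc n)
  then have "clamp_iter G n x = G n x" "\<bar>G (Suc n) x - G n x\<bar> \<le> 2 * (1/2)^n"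
    by auto
  then show ?case
    by (auto simp: max_def min_def)
qed simp

lemma osc_rank_le_imp_baire1:
  fixes f :: "'a::{metric_space,second_countable_topology} \<Rightarrow> real"
  assumes "osc_rank_le f a"
  shows "baire1 f"
proof -
  have "\<forall>n. \<exists>(G::nat \<Rightarrow> 'a \<Rightarrow> real) g. (\<forall>k. continuous_on UNIV (G k)) \<and>
    (\<forall>x. (\<forall>\<^sub>F k in sequentially. G k x = g x) \<and> \<bar>f x - g x\<bar> < (1/2)^n)"
    using assms by (intro allI small_oscillation_approx[where a = a]) (simp add: osc_rank_le_iff)
  then obtain G :: "nat \<Rightarrow> nat \<Rightarrow> 'a \<Rightarrow> real" and g where *:
    "\<forall>n. (\<forall>k. continuous_on UNIV (G n k)) \<and>
      (\<forall>x. (\<forall>\<^sub>F k in sequentially. G n k x = g n x) \<and> \<bar>f x - g n x\<bar> < (1/2)^n)"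
    unfolding choice_iff by (elim exE)
  then have G: "\<And>n k. continuous_on UNIV (G n k)" "\<And>n x. \<forall>\<^sub>F k in sequentially. G n k x = g n x"
    "\<And>n x. \<bar>f x - g n x\<bar> < (1/2)^n"
    by simp_all
  define F where "F = (\<lambda>k. clamp_iter (\<lambda>n. G n k) k)"
  have "(\<lambda>k. F k x) \<longlonglongrightarrow> f x" for x
  proof (rule LIMSEQ_I)
    fix r :: real assume "r > 0"
    \<comment> \<open>The 5 is 4 + 1: the clamped tail contributes 4 * 2^-n, and the distance from f
      to its n-th step function contributes 2^-n.\<close>
    then obtain n where n: "(1/2)^n < r / 5"
      using real_arch_pow_inv[of "r/5" "1/2"] by auto
    have "\<forall>\<^sub>F k in sequentially. \<forall>m\<in>{..n}. G m k x = g m x"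
      using G(2) by (intro eventually_ball_finite) auto
    moreover have "\<forall>\<^sub>F k in sequentially. n \<le> k"
      by (rule eventually_ge_at_top)
    ultimately have "\<forall>\<^sub>F k in sequentially. norm (F k x - f x) < r"
    proof eventually_elim
      case (elim k)
      have "clamp_iter (\<lambda>n. G n k) n x = G n k x"
      proof (rule clamp_iter_eq)
        fix m assume "m < n"
        then have "G m k x = g m x" "G (Suc m) k x = g (Suc m) x"
          using elim(1) by auto
        moreover have "(1/2::real)^Suc m \<le> (1/2)^m"
          by simp
        ultimately show "\<bar>G (Suc m) k x - G m k x\<bar> \<le> 2 * (1/2)^m"
          using G(3)[of x m] G(3)[of x "Suc m"] by linarith
      qed
      then have "clamp_iter (\<lambda>n. G n k) n x = g n x"
        using elim(1) by simp
      moreover have "\<bar>F k x - clamp_iter (\<lambda>n. G n k) n x\<bar> \<le> 4 * (1/2)^n"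
      proof -
        have "\<bar>F k x - clamp_iter (\<lambda>n. G n k) n x\<bar> \<le> 4 * (1/2)^n - 4 * (1/2)^k"
          using clamp_iter_diff[of "\<lambda>n. G n k" n "k - n" x] elim(2) by (simp add: F_def)
        moreover have "(0::real) \<le> (1/2)^k" by simp
        ultimately show ?thesis by linarith
      qed
      ultimately show ?case
        using G(3)[of x n] n by simp
    qed
    then show "\<exists>no. \<forall>k\<ge>no. norm (F k x - f x) < r"
      by (simp add: eventually_sequentially)
  qed
  moreover have "continuous_on UNIV (F k)" for k
    unfolding F_def using G(1) by (rule continuous_on_clamp_iter)
  ultimately show ?thesis
    unfolding baire1_def by blast
qed

lemma B1_iff:
  fixes f :: "'a::polish_space \<Rightarrow> real"
  shows "f \<in> B1 lam \<longleftrightarrow> (\<forall>e>0. deriv_iter (osc_der f e) (cord_wexp lam) UNIV = {})"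
  unfolding B1_def using osc_rank_le_imp_baire1[of f] by (auto simp: osc_rank_le_iff[symmetric])

section \<open>Sufficiency\<close>

text \<open>The condition that \<open>A\<close> lies in \<open>P\<close> in the step keeps pointwise
  bounds known on \<open>P\<close> available at every stage of the iteration.\<close>

lemma deriv_iter_local:
  assumes d: "derivation d" and d': "derivation d'" and P: "closed P" and Q: "closed Q"
    and PQ: "P \<inter> V \<subseteq> Q"
    and step: "\<And>A B. closed A \<Longrightarrow> closed B \<Longrightarrow> A \<subseteq> P \<Longrightarrow> A \<inter> V \<subseteq> B \<Longrightarrow> d A \<inter> V \<subseteq> d' B"
  shows "deriv_iter d a P \<inter> V \<subseteq> deriv_iter d' a Q"
proof (induction a)
  case OZero
  show ?case using PQ by simp
next
  case (OSucc a)
  then show ?case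
    using step[OF deriv_iter_closed[OF d P] deriv_iter_closed[OF d' Q] deriv_iter_subset[OF d P]]
    by simp
next
  case (OLim f)
  show ?case
  proof
    fix x assume "x \<in> deriv_iter d (OLim f) P \<inter> V"
    then have "x \<in> deriv_iter d (f n) P \<inter> V" for n
      by simp
    then have "x \<in> deriv_iter d' (f n) Q" for n
      using subsetD[OF OLim[OF rangeI]] by metis
    then show "x \<in> deriv_iter d' (OLim f) Q"
      by simp
  qed
qed

lemma delta_local:
  assumes V: "open V" and AB: "A \<inter> V \<subseteq> B"
    and cmp: "\<And>w w'. w \<in> A \<inter> V \<Longrightarrow> w' \<in> A \<inter> V \<Longrightarrow> \<bar>g w' - g w\<bar> \<ge> e \<Longrightarrow> \<bar>h w' - h w\<bar> \<ge> e'"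
  shows "delta g e A \<inter> V \<subseteq> delta h e' B"
proof -
  have "V \<inter> O_set g e A \<subseteq> O_set h e' B"
  proof
    fix w assume w: "w \<in> V \<inter> O_set g e A"
    then have "w \<in> A"
      using O_set_subset[of g e A] by blast
    show "w \<in> O_set h e' B"
    proof (rule in_O_setI)
      show "w \<in> B"
        using w AB \<open>w \<in> A\<close> by blast
      fix U assume "open U" "w \<in> U"
      then obtain w' where "w' \<in> A" "w' \<in> U \<inter> V" "\<bar>g w' - g w\<bar> \<ge> e"
        using in_O_setE[of w g e A "U \<inter> V"] w V by (metis IntD1 IntD2 IntI open_Int)
      then show "\<exists>y\<in>U \<inter> B. e' \<le> \<bar>h y - h w\<bar>"
        using cmp[of w w'] w \<open>w \<in> A\<close> AB by blast
    qed
  qed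
  then have "closure (V \<inter> O_set g e A) \<subseteq> closure (O_set h e' B)"
    by (rule closure_mono)
  then show ?thesis
    unfolding delta_def using open_Int_closure_subset[OF V, of "O_set g e A"] by blast
qed

lemma acc_local:
  assumes V: "open V" and AB: "A \<inter> V \<subseteq> B"
  shows "acc A \<inter> V \<subseteq> acc B"
proof
  fix x assume x: "x \<in> acc A \<inter> V"
  have "x islimpt B"
  proof (rule islimptI)
    fix T assume "x \<in> T" "open T"
    then obtain y where "y \<in> A" "y \<in> T \<inter> V" "y \<noteq> x"
      using x V islimptE[of x A "T \<inter> V"] unfolding acc_def by (metis IntD1 IntD2 IntI mem_Collect_eq open_Int)
    then show "\<exists>y\<in>B. y \<in> T \<and> y \<noteq> x"
      using AB by blast
  qed
  then show "x \<in> acc B" by (simp add: acc_def)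
qed

lemma hM_local:
  assumes "open V" "A \<inter> V \<subseteq> B"
  shows "hM h M A \<inter> V \<subseteq> hM h M B"
  unfolding hM_def using assms by (intro acc_local) auto

section \<open>Counting derivatives of the product\<close>

lemma delta_subset_acc:
  assumes "closed P" "e > 0" shows "delta g e P \<subseteq> acc P"
  using order_trans[OF delta_subset_osc_der[OF assms(1)] osc_der_subset_acc[OF assms(2)]] .

text \<open>Near z outside the derivative of f, the difference of the product at w' and w is h w' *
  (f w' - f w) + f w * (h w' - h w). The first summand is at most M * 2 * e/(4M) = e/2, so h moves
  by at least e/(2K), where K bounds |f| near z. This threshold depends on z, hence the assumption
  for every \<open>eta\<close>.\<close>

lemma delta_product_bounded:
  fixes h f :: "'a::metric_space \<Rightarrow> real"
  assumes P: "closed P" and "e > 0" "M > 0" and V: "open V"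
    and hE: "\<And>eta. eta > 0 \<Longrightarrow> deriv_iter (delta h eta) c P \<inter> V = {}"
    and Q: "closed Q" "Q \<subseteq> P" and bound: "\<And>x. x \<in> Q \<inter> V \<Longrightarrow> \<bar>h x\<bar> \<le> M"
  shows "deriv_iter (delta (\<lambda>x. h x * f x) e) c Q \<inter> V \<subseteq> delta f (e / (4 * M)) Q"
proof (rule ccontr)
  let ?e = "e / (4 * M)"
  assume "\<not> ?thesis"
  then obtain z where z: "z \<in> deriv_iter (delta (\<lambda>x. h x * f x) e) c Q" "z \<in> V" "z \<notin> delta f ?e Q"
    by blast
  have "z \<in> Q"
    using z(1) deriv_iter_subset[OF derivation_delta Q(1)] by blast
  moreover have "z \<notin> O_set f ?e Q"
    using z(3) closure_subset unfolding delta_def by blast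
  ultimately obtain W where W: "open W" "z \<in> W" "\<forall>y\<in>W \<inter> Q. \<bar>f y - f z\<bar> < ?e"
    using not_in_O_setE by metis
  define K where "K = \<bar>f z\<bar> + ?e"
  have "?e > 0" using \<open>e > 0\<close> \<open>M > 0\<close> by simp
  then have "K > 0" unfolding K_def by linarith
  then have eta: "e / (2 * K) > 0" using \<open>e > 0\<close> by simp
  have "deriv_iter (delta (\<lambda>x. h x * f x) e) c Q \<inter> (V \<inter> W) \<subseteq> deriv_iter (delta h (e / (2 * K))) c P"
  proof (rule deriv_iter_local[OF derivation_delta derivation_delta Q(1) P])
    show "Q \<inter> (V \<inter> W) \<subseteq> P" using Q(2) by blast
    fix A B :: "'a set" assume A: "A \<subseteq> Q" "A \<inter> (V \<inter> W) \<subseteq> B"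
    show "delta (\<lambda>x. h x * f x) e A \<inter> (V \<inter> W) \<subseteq> delta h (e / (2 * K)) B"
    proof (rule delta_local)
      show "open (V \<inter> W)" using V W(1) by (rule open_Int)
      fix w w' assume w: "w \<in> A \<inter> (V \<inter> W)" "w' \<in> A \<inter> (V \<inter> W)"
        and ge: "e \<le> \<bar>h w' * f w' - h w * f w\<bar>"
      have "\<bar>f w - f z\<bar> < ?e" "\<bar>f w' - f z\<bar> < ?e"
        using W(3) w A(1) by blast+
      then have f: "\<bar>f w' - f w\<bar> \<le> 2 * ?e" "\<bar>f w\<bar> \<le> K"
        unfolding K_def by linarith+
      have hw: "\<bar>h w'\<bar> \<le> M"
        using bound w(2) A(1) by blast
      have eq: "h w' * f w' - h w * f w = h w' * (f w' - f w) + f w * (h w' - h w)"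
        by (simp add: algebra_simps)
      have "e \<le> \<bar>h w' * (f w' - f w)\<bar> + \<bar>f w * (h w' - h w)\<bar>"
        using order_trans[OF ge[unfolded eq] abs_triangle_ineq] .
      moreover have "\<bar>h w' * (f w' - f w)\<bar> \<le> M * (2 * ?e)"
        unfolding abs_mult using f(1) hw by (intro mult_mono) auto
      moreover have "\<bar>f w * (h w' - h w)\<bar> \<le> K * \<bar>h w' - h w\<bar>"
        unfolding abs_mult using f(2) by (intro mult_right_mono) auto
      moreover have "M * (2 * ?e) = e / 2"
        using \<open>M > 0\<close> by simp
      ultimately have "e / 2 \<le> K * \<bar>h w' - h w\<bar>"
        by linarith
      then show "e / (2 * K) \<le> \<bar>h w' - h w\<bar>"
        using \<open>K > 0\<close> by (simp add: field_simps)
    qed (use A in simp)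
  qed
  then show False
    using z(1,2) W(2) hE[OF eta] by blast
qed

text \<open>The ordinal is read from the inside: c derivatives against one of f, c such blocks to
  exhaust f, one more for an isolated point, and all this c times against \<open>hM\<close>.\<close>

lemma delta_product_local:
  fixes h f :: "'a::metric_space \<Rightarrow> real"
  assumes P: "closed P" and e: "e > 0" and M: "M > 0" and U: "open U"
    and hE: "\<And>eta. eta > 0 \<Longrightarrow> deriv_iter (delta h eta) c P \<inter> U = {}"
    and fE: "deriv_iter (delta f (e / (4 * M))) c P \<inter> U = {}"
    and hME: "deriv_iter (hM h M) c P \<inter> U = {}"
  shows "deriv_iter (delta (\<lambda>x. h x * f x) e) (cord_mul (OSucc (cord_mul c c)) c) P \<inter> U = {}"
proof -
  let ?d = "delta (\<lambda>x. h x * f x) e"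
  let ?G = "deriv_iter ?d c"
  let ?J = "deriv_iter ?d (OSucc (cord_mul c c))"
  have G: "derivation ?G" and J: "derivation ?J"
    by (rule derivation_iter[OF derivation_delta])+
  have 1: "deriv_iter ?G c Q \<inter> V = {}"
    if Q: "closed Q" "Q \<subseteq> P" and V: "open V" "V \<subseteq> U" and bound: "\<And>x. x \<in> Q \<inter> V \<Longrightarrow> \<bar>h x\<bar> \<le> M" for Q V
  proof -
    have "deriv_iter ?G c Q \<inter> V \<subseteq> deriv_iter (delta f (e / (4 * M))) c P"
    proof (rule deriv_iter_local[OF G derivation_delta Q(1) P])
      show "Q \<inter> V \<subseteq> P" using Q(2) by blast
      fix A B :: "'a set" assume A: "closed A" "A \<subseteq> Q" "A \<inter> V \<subseteq> B"
      have "?G A \<inter> V \<subseteq> delta f (e / (4 * M)) A"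
      proof (rule delta_product_bounded[OF P e M V(1)])
        show "deriv_iter (delta h eta) c P \<inter> V = {}" if "eta > 0" for eta
          using hE[OF that] V(2) by blast
        show "A \<subseteq> P" using A Q by blast
        show "\<bar>h x\<bar> \<le> M" if "x \<in> A \<inter> V" for x
          using bound that A(2) by blast
      qed (rule A)
      moreover have "delta f (e / (4 * M)) A \<inter> V \<subseteq> delta f (e / (4 * M)) B"
        using V(1) A(3) by (rule delta_local)
      ultimately show "?G A \<inter> V \<subseteq> delta f (e / (4 * M)) B" by blast
    qed
    then show ?thesis
      using fE V(2) by blast
  qed
  have 2: "?J Q \<inter> U \<subseteq> hM h M Q" if Q: "closed Q" "Q \<subseteq> P" for Q
  proof (rule ccontr)
    assume "\<not> ?thesis"
    then obtain z where z: "z \<in> ?J Q" "z \<in> U" "z \<notin> hM h M Q"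
      by blast
    then obtain T where T: "z \<in> T" "open T" "\<forall>y\<in>Q \<inter> {x. \<bar>h x\<bar> > M}. y \<in> T \<longrightarrow> y = z"
      unfolding hM_def acc_def islimpt_def by auto
    \<comment> \<open>Near z, only z itself can be a point of \<open>Q\<close> with |h| > M. With z
      deleted, fact 1 applies, so at most z is left nearby after c * c derivatives, and the
      additional \<open>OSucc\<close> removes it.\<close>
    define V where "V = T \<inter> U - {z}"
    have "open V"
      unfolding V_def using T(2) U by (intro open_delete open_Int)
    have "deriv_iter ?G c Q \<inter> V = {}"
    proof (rule 1[OF Q \<open>open V\<close>])
      show "V \<subseteq> U" by (auto simp: V_def)
      show "\<bar>h x\<bar> \<le> M" if "x \<in> Q \<inter> V" for x
        using T(3) that by (force simp: V_def)
    qed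
    moreover have "?J Q \<subseteq> acc (deriv_iter ?G c Q)"
      using delta_subset_acc[OF deriv_iter_closed[OF G Q(1)] e] by (simp add: deriv_iter_mul)
    then have "z islimpt deriv_iter ?G c Q"
      using z(1) by (auto simp: acc_def)
    then obtain y where "y \<in> deriv_iter ?G c Q" "y \<in> T \<inter> U" "y \<noteq> z"
      using islimptE[of z _ "T \<inter> U"] T(1,2) U z(2) by (metis IntI open_Int)
    ultimately show False
      by (auto simp: V_def)
  qed
  have "deriv_iter ?J c P \<inter> U \<subseteq> deriv_iter (hM h M) c P"
  proof (rule deriv_iter_local[OF J derivation_hM P P])
    fix A B :: "'a set" assume A: "closed A" "A \<subseteq> P" "A \<inter> U \<subseteq> B"
    show "?J A \<inter> U \<subseteq> hM h M B"
      using 2[OF A(1,2)] hM_local[OF U A(3), of h M] by blast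
  qed blast
  then show ?thesis
    using hME by (auto simp: deriv_iter_mul)
qed

lemma strict_fundamental_sequence:
  assumes inc: "\<And>n. cord_less (xis n) (xis (Suc n))" and lim: "cord_eq (OLim xis) g"
  shows "m \<le> n \<Longrightarrow> cord_le (xis m) (xis n)" and "cord_le (OSucc (xis n)) g"
proof -
  show "cord_le (xis m) (xis n)" if "m \<le> n"
    using that
  proof (induction rule: dec_induct)
    case (step n)
    then show ?case
      using inc[of n] cord_le_SucD cord_le_trans unfolding cord_less_def by blast
  qed simp
  show "cord_le (OSucc (xis n)) g"
    using inc[of n] cord_le_Lim[of xis "Suc n"] lim cord_le_trans
    unfolding cord_less_def cord_eq_def by blast
qed

lemma delta_product_subset:
  fixes h f :: "'a::metric_space \<Rightarrow> real"
  assumes inc: "\<And>n. cord_less (xis n) (xis (Suc n))"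
    and lim: "cord_eq (OLim xis) (cord_wexp (cord_wexp xi))"
    and P: "closed P" and e: "e > 0" and M: "M > 0"
  shows "deriv_iter (delta (\<lambda>x. h x * f x) e) (cord_wexp (cord_wexp xi)) P \<subseteq>
    deriv_iter (delta f (e / (4 * M))) (cord_wexp (cord_wexp xi)) P \<union>
    deriv_iter (hM h M) (cord_wexp (cord_wexp xi)) P \<union> Omega h xis P"
proof (rule ccontr)
  let ?g = "cord_wexp (cord_wexp xi)"
  let ?d = "delta (\<lambda>x. h x * f x) e"
  assume "\<not> ?thesis"
  then obtain y where y: "y \<in> deriv_iter ?d ?g P"
    "y \<notin> deriv_iter (delta f (e / (4 * M))) ?g P" "y \<notin> deriv_iter (hM h M) ?g P" "y \<notin> Omega h xis P"
    by blast
  note fund = strict_fundamental_sequence[OF inc lim]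
  have "deriv_iter (delta f (e / (4 * M))) ?g P = (\<Inter>n. deriv_iter (delta f (e / (4 * M))) (xis n) P)"
    "deriv_iter (hM h M) ?g P = (\<Inter>n. deriv_iter (hM h M) (xis n) P)"
    using deriv_iter_eq[OF derivation_delta P lim] deriv_iter_eq[OF derivation_hM P lim] by auto
  then obtain n1 n2 n3 where n: "y \<notin> deriv_iter (delta f (e / (4 * M))) (xis n1) P"
    "y \<notin> deriv_iter (hM h M) (xis n2) P"
    "\<not> y islimpt (\<Union>eta\<in>{eta. eta > 0}. deriv_iter (delta h eta) (xis n3) P)"
    using y(2,3,4) by (auto simp: Omega_def acc_def)
  define N where "N = max n1 (max n2 n3)"
  define c where "c = xis N"
  have le: "cord_le (xis n1) c" "cord_le (xis n2) c" "cord_le (xis n3) c"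
    unfolding c_def N_def by (intro fund(1); simp)+
  obtain T where T: "open T" "y \<in> T"
    "\<forall>z\<in>(\<Union>eta\<in>{eta. eta > 0}. deriv_iter (delta h eta) (xis n3) P). z \<in> T \<longrightarrow> z = y"
    using n(3) unfolding islimpt_def by blast
  define W where "W = - deriv_iter (delta f (e / (4 * M))) c P \<inter> - deriv_iter (hM h M) c P \<inter> T"
  have "open W"
    unfolding W_def
    by (intro open_Int open_Compl deriv_iter_closed[OF derivation_delta P]
        deriv_iter_closed[OF derivation_hM P] T(1))
  have "y \<in> W"
    using n(1,2) T(2) deriv_iter_antimono[OF derivation_delta P le(1)]
      deriv_iter_antimono[OF derivation_hM P le(2)] unfolding W_def by blast
  define m where "m = cord_mul (OSucc (cord_mul c c)) c"
  \<comment> \<open>\<open>Omega\<close> consists of accumulation points, so the iterates of h may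
    still contain y itself. The count is therefore run on W - {y}; the derivative after the first m
    then removes the isolated y, and m + 1 still fits below \<Gamma>.\<close>
  have "deriv_iter ?d m P \<inter> (W - {y}) = {}"
    unfolding m_def
  proof (rule delta_product_local[OF P e M])
    show "open (W - {y})" using \<open>open W\<close> by (rule open_delete)
    show "deriv_iter (delta h eta) c P \<inter> (W - {y}) = {}" if "eta > 0" for eta
    proof -
      have "deriv_iter (delta h eta) c P \<subseteq> deriv_iter (delta h eta) (xis n3) P"
        by (rule deriv_iter_antimono[OF derivation_delta P le(3)])
      then show ?thesis
        using T(3) that unfolding W_def by blast
    qed
  qed (auto simp: W_def)
  moreover have "cord_le (OSucc m) ?g"
    unfolding m_def
    by (intro cord_mul_less_wexp_wexp Suc_less_cord_wexp one_le_cord_wexp) (simp_all add: c_def fund(2))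
  then have "deriv_iter ?d ?g P \<subseteq> ?d (deriv_iter ?d m P)"
    using deriv_iter_antimono[OF derivation_delta P, of "OSucc m"] by simp
  then have "y \<in> acc (deriv_iter ?d m P)"
    using y(1) delta_subset_acc[OF deriv_iter_closed[OF derivation_delta P] e] by blast
  then obtain z where "z \<in> deriv_iter ?d m P" "z \<in> W" "z \<noteq> y"
    using islimptE[of y _ W] \<open>open W\<close> \<open>y \<in> W\<close> unfolding acc_def by blast
  ultimately show False by blast
qed

lemma deriv_iter_cnf:
  assumes "derivation d" "cord_eq kap (cord_add (cord_wexp xi) al)"
  shows "deriv_iter d (cord_wexp kap) UNIV =
    deriv_iter (deriv_iter d (cord_wexp (cord_wexp xi))) (cord_wexp al) UNIV"
  using deriv_iter_eq[OF assms(1) closed_UNIV cord_wexp_eq[OF assms(2)]]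
  by (simp add: deriv_iter_wexp_add)

lemma multiplier_sufficient:
  fixes h :: "'a::polish_space \<Rightarrow> real"
  assumes kap: "cord_eq kap (cord_add (cord_wexp xi) al)"
    and inc: "\<And>n. cord_less (xis n) (xis (Suc n))"
    and lim: "cord_eq (OLim xis) (cord_wexp (cord_wexp xi))"
    and hM: "(\<Inter>M \<in> {M::real. M > 0}. deriv_iter (hM h M) (cord_wexp kap) UNIV) = {}"
    and Om: "deriv_iter (Omega h xis) (cord_wexp al) UNIV = {}"
    and f: "f \<in> B1 kap"
  shows "(\<lambda>x. h x * f x) \<in> B1 kap"
  unfolding B1_iff
proof (intro allI impI)
  fix e :: real assume "e > 0"
  then have e: "e / 2 > 0" by simp
  let ?k = "cord_wexp kap" and ?g = "cord_wexp (cord_wexp xi)"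
  let ?hf = "\<lambda>x. h x * f x"
  have "x \<notin> deriv_iter (osc_der ?hf e) ?k UNIV" for x
  proof
    assume x: "x \<in> deriv_iter (osc_der ?hf e) ?k UNIV"
    \<comment> \<open>Only the intersection over all M is assumed empty, so M depends on x and the
      argument runs point by point.\<close>
    obtain M where M: "M > 0" "x \<notin> deriv_iter (hM h M) ?k UNIV"
      using hM by blast
    \<comment> \<open>The 2 comes from passing to centred oscillation, the 4M from the estimate for
      the product.\<close>
    define e' where "e' = (e / 2) / (4 * M)"
    have "e' > 0" using e M(1) by (simp add: e'_def)
    have "deriv_iter (osc_der ?hf e) ?k UNIV \<subseteq> deriv_iter (delta ?hf (e / 2)) ?k UNIV"
      by (rule deriv_iter_le[OF derivation_osc_der derivation_delta]) (simp_all add: osc_der_subset_delta)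
    also have "\<dots> = deriv_iter (deriv_iter (delta ?hf (e / 2)) ?g) (cord_wexp al) UNIV"
      by (rule deriv_iter_cnf[OF derivation_delta kap])
    also have "\<dots> \<subseteq> deriv_iter (deriv_iter (delta f e') ?g) (cord_wexp al) UNIV \<union>
        deriv_iter (deriv_iter (hM h M) ?g) (cord_wexp al) UNIV \<union>
        deriv_iter (Omega h xis) (cord_wexp al) UNIV"
      unfolding e'_def
      by (intro deriv_iter_wexp_union_subset derivation_iter additive_iter derivation_delta
          additive_delta derivation_hM derivation_Omega delta_product_subset inc lim e M(1) closed_UNIV)
    also have "\<dots> = deriv_iter (delta f e') ?k UNIV \<union> deriv_iter (hM h M) ?k UNIV"
      using deriv_iter_cnf[OF derivation_delta kap, of f e'] deriv_iter_cnf[OF derivation_hM kap, of h M] Om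
      by simp
    also have "deriv_iter (delta f e') ?k UNIV \<subseteq> deriv_iter (osc_der f e') ?k UNIV"
      by (rule deriv_iter_le[OF derivation_delta derivation_osc_der]) (simp_all add: delta_subset_osc_der)
    also have "\<dots> = {}"
      using f \<open>e' > 0\<close> by (simp add: B1_iff)
    finally show False
      using x M(2) by blast
  qed
  then show "deriv_iter (osc_der ?hf e) ?k UNIV = {}" by blast
qed

section \<open>Necessity\<close>

definition bouquet :: "'a::metric_space \<Rightarrow> (nat \<Rightarrow> 'a) \<Rightarrow> (nat \<Rightarrow> 'a set) \<Rightarrow> (nat \<Rightarrow> 'a set) \<Rightarrow> 'a set \<Rightarrow> bool" where
  "bouquet x y Sj U S \<longleftrightarrow> closed S \<and> S = insert x (\<Union>j. Sj j) \<and> y \<longlonglongrightarrow> x \<and>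
     (\<forall>j. y j \<in> Sj j \<and> x \<notin> Sj j \<and> closed (Sj j) \<and> open (U j) \<and> S \<inter> U j = Sj j)"

lemma bouquetD:
  assumes "bouquet x y Sj U S"
  shows "closed S" "x \<in> S" "S = insert x (\<Union>j. Sj j)" "y \<longlonglongrightarrow> x" "y j \<in> Sj j" "x \<notin> Sj j"
    "closed (Sj j)" "open (U j)" "S \<inter> U j = Sj j" "Sj j \<subseteq> S"
  using assms unfolding bouquet_def by auto

lemma converging_choice:
  fixes x :: "'a::metric_space"
  assumes "r > 0" and "\<And>j. x islimpt A j"
  shows "\<exists>y. \<forall>j::nat. (y j \<in> A j \<and> y j \<noteq> x \<and> dist (y j) x < r / 2) \<and>
    dist (y (Suc j)) x < dist (y j) x / 2"
proof -
  have *: "\<exists>y. y \<in> A j \<and> y \<noteq> x \<and> dist y x < t" if "t > 0" for j t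
    using assms(2)[of j] that by (auto simp: islimpt_approachable)
  show ?thesis
  proof (rule dependent_nat_choice)
    show "\<exists>y. y \<in> A 0 \<and> y \<noteq> x \<and> dist y x < r / 2"
      using *[of "r / 2"] assms(1) by simp
    fix y :: 'a and n assume y: "y \<in> A n \<and> y \<noteq> x \<and> dist y x < r / 2"
    then have "dist y x / 2 > 0" by simp
    from *[OF this, of "Suc n"] obtain z where "z \<in> A (Suc n)" "z \<noteq> x" "dist z x < dist y x / 2"
      by blast
    then show "\<exists>z. (z \<in> A (Suc n) \<and> z \<noteq> x \<and> dist z x < r / 2) \<and> dist z x < dist y x / 2"
      using y zero_le_dist[of y x] by (intro exI[of _ z]) linarith
  qed
qed

text \<open>\<open>A\<close> (where the child roots are found) and \<open>Pr\<close> (what each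
  subtree satisfies) stay abstract so that the three kinds of trees below share one gluing.\<close>

lemma bouquet_exists:
  fixes x :: "'a::metric_space" and A :: "nat \<Rightarrow> 'a set" and Pr :: "nat \<Rightarrow> 'a \<Rightarrow> 'a set \<Rightarrow> ('a \<Rightarrow> real) \<Rightarrow> bool"
  assumes r: "r > 0" and lim: "\<And>j. x islimpt A j"
    and ex: "\<And>j y \<rho>. y \<in> A j \<Longrightarrow> \<rho> > 0 \<Longrightarrow> \<exists>S f. closed S \<and> y \<in> S \<and> S \<subseteq> ball y \<rho> \<and> Pr j y S f"
  obtains y Sj fj U S f where "bouquet x y Sj U S" "S \<subseteq> ball x r"
    "\<forall>p. p \<notin> (\<Union>j. Sj j) \<longrightarrow> f p = 0" "\<forall>j. \<forall>p\<in>Sj j. f p = fj j p"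
    "\<forall>j. y j \<in> A j" "\<forall>j. Pr j (y j) (Sj j) (fj j)"
proof -
  obtain y where y: "\<And>j. y j \<in> A j" "\<And>j. y j \<noteq> x" "\<And>j. dist (y j) x < r / 2"
    "\<And>j. dist (y (Suc j)) x < dist (y j) x / 2"
    using converging_choice[of r x A, OF r lim] by metis
  define d where "d = (\<lambda>j. dist (y j) x)"
  have dpos: "d j > 0" for j using y(2) by (simp add: d_def)
  have "\<forall>j. \<exists>S f. closed S \<and> y j \<in> S \<and> S \<subseteq> ball (y j) (d j / 4) \<and> Pr j (y j) S f"
    using ex[OF y(1)] dpos by simp
  then obtain Sj fj where "\<forall>j. closed (Sj j) \<and> y j \<in> Sj j \<and> Sj j \<subseteq> ball (y j) (d j / 4) \<and> Pr j (y j) (Sj j) (fj j)"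
    unfolding choice_iff by (elim exE)
  then have Sj: "\<And>j. closed (Sj j)" "\<And>j. y j \<in> Sj j" "\<And>j. Sj j \<subseteq> ball (y j) (d j / 4)"
    "\<And>j. Pr j (y j) (Sj j) (fj j)"
    by simp_all
  define U where "U = (\<lambda>j. ball (y j) (d j / 4))"
  \<comment> \<open>The balls lie in shells around x between 3/4 and 5/4 of \<open>d j\<close>. The
    distances more than halve at each step, and 5/4 * 1/2 < 3/4 separates the shells;
    \<open>d j\<close> < r/2 keeps them inside the ball of radius r.\<close>
  have U: "dist p x < 5/4 * d j" "dist p x > 3/4 * d j" if "p \<in> U j" for p j
  proof -
    have "dist (y j) p < d j / 4" using that by (simp add: U_def)
    moreover have "dist p x \<le> dist (y j) p + d j" "d j \<le> dist (y j) p + dist p x"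
      unfolding d_def by (metis dist_commute dist_triangle, metis dist_triangle)
    ultimately show "dist p x < 5/4 * d j" "dist p x > 3/4 * d j" by linarith+
  qed
  have d_dec: "d j \<le> d i" if "i \<le> j" for i j
    using that
  proof (induction rule: dec_induct)
    case (step n)
    then show ?case using y(4)[of n] dpos[of n] unfolding d_def by linarith
  qed simp
  have d_half: "d j < d i / 2" if "i < j" for i j
    using d_dec[of "Suc i" j] y(4)[of i] that unfolding d_def by linarith
  have disj: "i = j" if "p \<in> U i" "p \<in> U j" for i j p
  proof (rule ccontr)
    assume "i \<noteq> j"
    then consider "i < j" | "j < i" by linarith
    then show False
      using U[OF that(1)] U[OF that(2)] d_half[of i j] d_half[of j i] dpos[of i] dpos[of j]
      by cases linarith+
  qed
  have d_le: "d j \<le> r / 2 * (1/2)^j" for j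
  proof (induction j)
    case 0
    then show ?case using y(3)[of 0] by (simp add: d_def)
  next
    case (Suc j)
    then show ?case using d_half[of j "Suc j"] by simp
  qed
  have d_lim: "d \<longlonglongrightarrow> 0"
  proof (rule tendsto_sandwich[of "\<lambda>_. 0" d sequentially "\<lambda>j. r / 2 * (1/2)^j"])
    show "(\<lambda>j. r / 2 * (1/2)^j) \<longlonglongrightarrow> 0"
      using tendsto_mult_left[OF LIMSEQ_power_zero[of "1/2::real"], of "r/2"] by simp
  qed (use dpos d_le in \<open>auto intro!: always_eventually less_imp_le\<close>)
  define S where "S = insert x (\<Union>j. Sj j)"
  have SjU: "Sj j \<subseteq> U j" for j using Sj(3) by (simp add: U_def)
  have xU: "x \<notin> U j" for j
    using U(2)[of x j] dpos[of j] by auto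
  \<comment> \<open>For each N all but finitely many subtrees lie in one closed ball about x, and
    these balls shrink to x.\<close>
  have "S = (\<Inter>N. cball x (5/4 * d N) \<union> (\<Union>j<N. Sj j))"
  proof (intro equalityI subsetI INT_I)
    fix p N assume "p \<in> S"
    then consider "p = x" | j where "p \<in> Sj j" by (auto simp: S_def)
    then show "p \<in> cball x (5/4 * d N) \<union> (\<Union>j<N. Sj j)"
    proof cases
      case 1
      then show ?thesis using dpos[of N] by simp
    next
      case 2
      show ?thesis
      proof (cases "j < N")
        case False
        then have "d j \<le> d N" using d_dec by simp
        then show ?thesis
          using U(1)[of p j] 2 SjU[of j] by (auto simp: dist_commute)
      qed (use 2 in auto)
    qed
  next
    fix p assume p: "p \<in> (\<Inter>N. cball x (5/4 * d N) \<union> (\<Union>j<N. Sj j))"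
    show "p \<in> S"
    proof (cases "p = x")
      case False
      then have "dist p x / 2 > 0" by simp
      then have "\<forall>\<^sub>F N in sequentially. d N < dist p x / 2"
        using d_lim by (rule order_tendstoD(2)[rotated])
      then obtain N where "d N < dist p x / 2"
        using eventually_happens'[OF sequentially_bot] by blast
      then have "p \<notin> cball x (5/4 * d N)"
        using dpos[of N] by (simp add: dist_commute)
      then show ?thesis using p by (auto simp: S_def)
    qed (simp add: S_def)
  qed
  moreover have "closed (cball x (5/4 * d N) \<union> (\<Union>j<N. Sj j))" for N
    using Sj(1) by (intro closed_Un closed_UN) auto
  ultimately have "closed S"
    by (simp add: closed_INT)
  have ylim: "y \<longlonglongrightarrow> x"
    using d_lim unfolding d_def by (rule tendsto_dist_iff[THEN iffD2])
  have "S \<inter> U j = Sj j" for j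
  proof (intro equalityI subsetI)
    fix p assume p: "p \<in> S \<inter> U j"
    then obtain i where "p \<in> Sj i" using xU[of j] by (auto simp: S_def)
    then show "p \<in> Sj j" using disj[of p i j] SjU[of i] p by auto
  qed (use SjU in \<open>auto simp: S_def\<close>)
  moreover have "x \<notin> Sj j" "open (U j)" for j
    using xU[of j] SjU[of j] by (blast, simp add: U_def)
  ultimately have b: "bouquet x y Sj U S"
    unfolding bouquet_def using \<open>closed S\<close> ylim Sj(1,2) S_def by simp
  have "S \<subseteq> ball x r"
  proof
    fix p assume "p \<in> S"
    then consider "p = x" | j where "p \<in> U j" using SjU by (auto simp: S_def)
    then show "p \<in> ball x r"
    proof cases
      case 2
      then show ?thesis
        using U(1)[of p j] y(3)[of j] r by (simp add: d_def dist_commute)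
    qed (use r in simp)
  qed
  \<comment> \<open>Disjointness makes the index unique. At the root x the value is 0; callers that
    want another root value overwrite it.\<close>
  define f where "f = (\<lambda>p. if \<exists>j. p \<in> Sj j then fj (THE j. p \<in> Sj j) p else 0)"
  have "f p = fj j p" if "p \<in> Sj j" for j p
  proof -
    have "(THE j. p \<in> Sj j) = j"
      using that disj SjU by (intro the_equality) blast+
    then show ?thesis using that by (auto simp: f_def)
  qed
  then have f: "\<forall>j. \<forall>p\<in>Sj j. f p = fj j p" by simp
  have "\<forall>p. p \<notin> (\<Union>j. Sj j) \<longrightarrow> f p = 0"
    by (auto simp: f_def)
  then show thesis
    by (rule that[OF b \<open>S \<subseteq> ball x r\<close> _ f]) (use y(1) Sj(4) in simp_all)
qed

lemma osc_der_local:
  assumes V: "open V" and AB: "A \<inter> V \<subseteq> B"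
  shows "osc_der f e A \<inter> V \<subseteq> osc_der f e B"
proof
  fix x assume x: "x \<in> osc_der f e A \<inter> V"
  show "x \<in> osc_der f e B"
  proof (rule in_osc_derI)
    show "x \<in> B" using x osc_der_subset[of f e A] AB by blast
    fix U assume "open U" "x \<in> U"
    then have "open (U \<inter> V)" "x \<in> U \<inter> V" using V x by auto
    then obtain x1 x2 where "x1 \<in> A" "x1 \<in> U \<inter> V" "x2 \<in> A" "x2 \<in> U \<inter> V" "\<bar>f x1 - f x2\<bar> \<ge> e"
      using x in_osc_derE[of x f e A "U \<inter> V"] by (metis IntD1)
    then show "\<exists>x1\<in>B \<inter> U. \<exists>x2\<in>B \<inter> U. e \<le> \<bar>f x1 - f x2\<bar>"
      using AB by blast
  qed
qed

text \<open>Each subtree is relatively open in the bouquet, so a local derivation acts on it as if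
  it were alone; only the root can survive because of the whole.\<close>

lemma bouquet_deriv_iter:
  assumes b: "bouquet x y Sj U S" and d: "derivation d"
    and local: "\<And>V A B. open V \<Longrightarrow> A \<inter> V \<subseteq> B \<Longrightarrow> d A \<inter> V \<subseteq> d B"
  shows "deriv_iter d a S \<subseteq> insert x (\<Union>j. deriv_iter d a (Sj j))"
proof
  note b = bouquetD[OF b]
  fix p assume p: "p \<in> deriv_iter d a S"
  then have "p \<in> S" using deriv_iter_subset[OF d b(1)] by blast
  then consider "p = x" | j where "p \<in> Sj j" using b(3) by auto
  then show "p \<in> insert x (\<Union>j. deriv_iter d a (Sj j))"
  proof cases
    case 2
    have "deriv_iter d a S \<inter> U j \<subseteq> deriv_iter d a (Sj j)"
      using b(9)[of j] local[OF b(8)] by (intro deriv_iter_local[OF d d b(1,7)]) auto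
    then show ?thesis using p 2 b(9)[of j] by blast
  qed simp
qed

text \<open>Children are numbered by codes of pairs (i, k), where i selects the ordinal stage. So
  every stage occurs infinitely often, at roots that tend to x.\<close>

lemma tendsto_prod_encode:
  assumes "y \<longlonglongrightarrow> x" shows "(\<lambda>k. y (prod_encode (i, k))) \<longlonglongrightarrow> x"
proof -
  have "filterlim (\<lambda>k. prod_encode (i, k)) at_top sequentially"
    by (rule filterlim_at_top_mono[OF filterlim_ident]) (simp add: le_prod_encode_2)
  then show ?thesis
    by (rule filterlim_compose[OF assms])
qed

lemma closed_prod_encode:
  assumes "y \<longlonglongrightarrow> x" "closed R" "\<And>k. y (prod_encode (i, k)) \<in> R"
  shows "x \<in> R"
  by (rule closed_sequentially[OF assms(2) _ tendsto_prod_encode[OF assms(1)]]) (rule assms(3))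

subsection \<open>The local bounds of a multiplier\<close>

text \<open>The condition on \<open>acc\<close> bounds the Cantor-Bendixson rank of S, and with it
  the oscillation rank of every function on S. The bound 1/M is the least value that a factor |h| >
  M surely lifts to 1; it is small when M is large.\<close>

definition hM_tree :: "('a::metric_space \<Rightarrow> real) \<Rightarrow> real \<Rightarrow> cord \<Rightarrow> 'a \<Rightarrow> 'a set \<Rightarrow> ('a \<Rightarrow> real) \<Rightarrow> bool" where
  "hM_tree h M a y S f \<longleftrightarrow> (\<forall>p\<in>S. 0 \<le> f p \<and> f p \<le> 1 / M) \<and> deriv_iter acc a S \<subseteq> {y} \<and>
     (\<forall>g. (\<forall>p\<in>S - {y}. g p = h p * f p) \<longrightarrow> y \<in> deriv_iter (osc_der g 1) a S)"

text \<open>The value of \<open>f\<close> at the root of a tree is free. The children of a root are therefore given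
the values 0 and 1/M alternately, which makes the product oscillate at the root.\<close>

lemma hM_tree_step:
  fixes h :: "'a::metric_space \<Rightarrow> real" and M :: "nat \<Rightarrow> real"
  assumes r: "r > 0" and M: "\<And>j. M j > 0"
    and lim: "\<And>j. x islimpt deriv_iter (hM h (M j)) (s (fst (prod_decode j))) UNIV \<inter> {z. \<bar>h z\<bar> > M j}"
    and IH: "\<And>j y \<rho>. y \<in> deriv_iter (hM h (M j)) (s (fst (prod_decode j))) UNIV \<Longrightarrow> \<rho> > 0 \<Longrightarrow>
      \<exists>S f. closed S \<and> y \<in> S \<and> S \<subseteq> ball y \<rho> \<and> hM_tree h (M j) (s (fst (prod_decode j))) y S f"
    and a: "cord_eq a (OLim (\<lambda>n. OSucc (s n)))"
  obtains y Sj U S f where "bouquet x y Sj U S" "S \<subseteq> ball x r" "\<forall>p. p \<notin> (\<Union>j. Sj j) \<longrightarrow> f p = 0"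
    "\<forall>j. \<forall>p\<in>Sj j. 0 \<le> f p \<and> f p \<le> 1 / M j" "\<forall>j. deriv_iter acc a (Sj j) = {}"
    "\<forall>g. (\<forall>p\<in>S - {x}. g p = h p * f p) \<longrightarrow> x \<in> deriv_iter (osc_der g 1) a S"
proof -
  define idx where "idx = (\<lambda>j. s (fst (prod_decode j)))"
  define col where "col = (\<lambda>j. if even (snd (prod_decode j)) then 0 else 1 / M j)"
  define Pr where "Pr = (\<lambda>j y S f. (\<forall>p\<in>S. 0 \<le> f p \<and> f p \<le> 1 / M j) \<and> deriv_iter acc (idx j) S \<subseteq> {y} \<and>
     f y = col j \<and> (\<forall>g. (\<forall>p\<in>S. g p = h p * f p) \<longrightarrow> y \<in> deriv_iter (osc_der g 1) (idx j) S))"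
  have ex: "\<exists>S f. closed S \<and> y \<in> S \<and> S \<subseteq> ball y \<rho> \<and> Pr j y S f"
    if y: "y \<in> deriv_iter (hM h (M j)) (idx j) UNIV \<inter> {z. \<bar>h z\<bar> > M j}" and \<rho>: "\<rho> > 0" for j y \<rho>
  proof -
    have "y \<in> deriv_iter (hM h (M j)) (s (fst (prod_decode j))) UNIV"
      using y by (simp add: idx_def)
    from IH[OF this \<rho>] obtain S f where S: "closed S" "y \<in> S" "S \<subseteq> ball y \<rho>" "hM_tree h (M j) (idx j) y S f"
      unfolding idx_def by (elim exE conjE)
    have "Pr j y S (f(y := col j))"
    proof -
      have 1: "\<forall>p\<in>S. 0 \<le> f p \<and> f p \<le> 1 / M j" and 2: "deriv_iter acc (idx j) S \<subseteq> {y}"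
        and 3: "\<And>g. (\<forall>p\<in>S - {y}. g p = h p * f p) \<Longrightarrow> y \<in> deriv_iter (osc_der g 1) (idx j) S"
        using S(4) unfolding hM_tree_def by simp_all
      have "y \<in> deriv_iter (osc_der g 1) (idx j) S" if "\<forall>p\<in>S. g p = h p * (f(y := col j)) p" for g
        by (rule 3) (use that in auto)
      moreover have "0 \<le> col j \<and> col j \<le> 1 / M j"
        using M[of j] by (simp add: col_def)
      ultimately show ?thesis
        unfolding Pr_def using 1 2 by simp
    qed
    then show ?thesis using S(1-3) by (intro exI[of _ S] exI[of _ "f(y := col j)"]) simp
  qed
  from lim have lim': "x islimpt deriv_iter (hM h (M j)) (idx j) UNIV \<inter> {z. \<bar>h z\<bar> > M j}" for j
    by (simp add: idx_def)
  obtain y Sj fj U S f where b: "bouquet x y Sj U S" and S: "S \<subseteq> ball x r"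
    and f0: "\<forall>p. p \<notin> (\<Union>j. Sj j) \<longrightarrow> f p = 0" and fj': "\<forall>j. \<forall>p\<in>Sj j. f p = fj j p"
    and yA': "\<forall>j. y j \<in> deriv_iter (hM h (M j)) (idx j) UNIV \<inter> {z. \<bar>h z\<bar> > M j}"
    and Pr': "\<forall>j. Pr j (y j) (Sj j) (fj j)"
    by (rule bouquet_exists[where A = "\<lambda>j. deriv_iter (hM h (M j)) (idx j) UNIV \<inter> {z. \<bar>h z\<bar> > M j}"
          and Pr = Pr, OF r lim' ex])
  note fj = fj'[rule_format] and yA = yA'[rule_format] and Pr = Pr'[rule_format]
  note bD = bouquetD[OF b]
  have "0 \<le> f p \<and> f p \<le> 1 / M j" if "p \<in> Sj j" for j p
    using Pr[of j] that fj[OF that] unfolding Pr_def by simp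
  moreover have "deriv_iter acc a (Sj j) = {}" for j
  proof -
    \<comment> \<open>One derivative after stage \<open>idx j\<close> removes the remaining root,
      and this is still within \<open>a\<close>.\<close>
    have "deriv_iter acc a (Sj j) \<subseteq> acc (deriv_iter acc (idx j) (Sj j))"
      using deriv_iter_sup[OF derivation_acc bD(7) a] unfolding idx_def by blast
    also have "\<dots> \<subseteq> acc {y j}"
      using Pr[of j] unfolding Pr_def by (intro acc_mono) blast
    finally show ?thesis by simp
  qed
  moreover have "x \<in> deriv_iter (osc_der g 1) a S" if g: "\<And>p. p \<in> S - {x} \<Longrightarrow> g p = h p * f p" for g
  proof -
    have gj: "g p = h p * fj j p" if "p \<in> Sj j" for p j
      using g[of p] that fj[OF that] bD(6)[of j] bD(10)[of j] by auto
    have "x \<in> osc_der g 1 (deriv_iter (osc_der g 1) (s i) S)" for i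
    proof -
      let ?R = "deriv_iter (osc_der g 1) (s i) S"
      define z where "z = (\<lambda>k. y (prod_encode (i, k)))"
      have zlim: "z \<longlonglongrightarrow> x"
        unfolding z_def by (rule tendsto_prod_encode[OF bD(4)])
      have yR: "y j \<in> deriv_iter (osc_der g 1) (idx j) S" for j
      proof -
        have "y j \<in> deriv_iter (osc_der g 1) (idx j) (Sj j)"
          using Pr[of j] gj unfolding Pr_def by simp
        then show ?thesis
          by (rule subsetD[OF deriv_iter_mono[OF derivation_osc_der bD(7,1,10)]])
      qed
      have zR: "z k \<in> ?R" for k
        using yR[of "prod_encode (i, k)"] by (simp add: z_def idx_def)
      have cl: "closed ?R"
        by (rule deriv_iter_closed[OF derivation_osc_der bD(1)])
      have "x \<in> ?R"
        by (rule closed_prod_encode[OF bD(4) cl]) (use zR in \<open>simp add: z_def\<close>)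
      then show ?thesis
      proof (rule in_osc_derI)
        fix V assume "open V" "x \<in> V"
        then obtain K where K: "\<And>k. k \<ge> K \<Longrightarrow> z k \<in> V"
          using topological_tendstoD[OF zlim \<open>open V\<close> \<open>x \<in> V\<close>] unfolding eventually_sequentially by auto
        have gz: "g (z k) = h (z k) * col (prod_encode (i, k))" for k
          using gj[OF bD(5)] Pr[of "prod_encode (i, k)"] unfolding Pr_def z_def by simp
        \<comment> \<open>The indices 2K and 2K + 1 both lie beyond K and carry the two different
          values.\<close>
        let ?j = "prod_encode (i, 2 * K + 1)"
        have "\<bar>h (y ?j)\<bar> > M ?j" using yA by blast
        then have "\<bar>g (z (2 * K + 1))\<bar> \<ge> 1"
          using M[of ?j] by (simp add: gz col_def abs_mult) (simp add: z_def)
        moreover have "g (z (2 * K)) = 0"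
          by (simp add: gz col_def)
        ultimately have "\<bar>g (z (2 * K + 1)) - g (z (2 * K))\<bar> \<ge> 1"
          by simp
        then show "\<exists>x1\<in>?R \<inter> V. \<exists>x2\<in>?R \<inter> V. 1 \<le> \<bar>g x1 - g x2\<bar>"
          using zR K[of "2 * K + 1"] K[of "2 * K"]
          by (intro bexI[of _ "z (2 * K + 1)"] bexI[of _ "z (2 * K)"]) auto
      qed
    qed
    then show ?thesis
      unfolding deriv_iter_sup[OF derivation_osc_der bD(1) a] by simp
  qed
  ultimately show thesis
    by (intro that[OF b S f0]) simp_all
qed

lemma hM_iterate_limpt:
  fixes h :: "'a::metric_space \<Rightarrow> real"
  assumes "cord_eq a (OLim (\<lambda>n. OSucc (s n)))" "x \<in> deriv_iter (hM h M) a UNIV"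
  shows "x islimpt deriv_iter (hM h M) (s i) UNIV \<inter> {z. \<bar>h z\<bar> > M}"
  using assms(2) unfolding deriv_iter_sup[OF derivation_hM closed_UNIV assms(1)]
  by (auto simp: hM_def acc_def)

lemma hM_tree_exists:
  fixes h :: "'a::metric_space \<Rightarrow> real"
  assumes "M > 0" "x \<in> deriv_iter (hM h M) a UNIV" "r > 0"
  shows "\<exists>S f. closed S \<and> x \<in> S \<and> S \<subseteq> ball x r \<and> hM_tree h M a x S f"
  using assms(2,3)
proof (induction a arbitrary: x r rule: cord_sup_induct)
  case (zero a)
  have "hM_tree h M a x {x} (\<lambda>_. 0)"
    unfolding hM_tree_def
    using assms(1) deriv_iter_zero[OF derivation_osc_der _ zero(1), of "{x}"]
      deriv_iter_zero[OF derivation_acc _ zero(1), of "{x}"] by simp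
  then show ?case
    using zero by (intro exI[of _ "{x}"] exI[of _ "\<lambda>_. 0"]) simp
next
  case (sup a s)
  obtain y Sj U S f where b: "bouquet x y Sj U S" and S: "S \<subseteq> ball x r"
    and f0: "\<forall>p. p \<notin> (\<Union>j. Sj j) \<longrightarrow> f p = 0"
    and f: "\<forall>j. \<forall>p\<in>Sj j. 0 \<le> f p \<and> f p \<le> 1 / M" and ac: "\<forall>j. deriv_iter acc a (Sj j) = {}"
    and g: "\<forall>g. (\<forall>p\<in>S - {x}. g p = h p * f p) \<longrightarrow> x \<in> deriv_iter (osc_der g 1) a S"
    by (rule hM_tree_step[where M = "\<lambda>_. M", OF \<open>r > 0\<close> assms(1) hM_iterate_limpt[OF sup(1,3)] sup(2) sup(1)])
  note bD = bouquetD[OF b]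
  have "deriv_iter acc a S \<subseteq> {x}"
    using bouquet_deriv_iter[OF b derivation_acc acc_local, of a] ac by simp
  moreover have "0 \<le> f p \<and> f p \<le> 1 / M" for p
    using f f0 assms(1) by (cases "p \<in> (\<Union>j. Sj j)") auto
  ultimately have "hM_tree h M a x S f"
    unfolding hM_tree_def using g by blast
  then show ?case
    using bD(1,2) S by (intro exI[of _ S] exI[of _ f]) simp
qed

text \<open>With M = j + 1 on the j-th subtree, f tends to 0 at x. For fixed e only finitely many
  subtrees matter, each of them emptied by omega^kap derivatives, while the product still oscillates
  by 1 at x.\<close>

lemma multiplier_necessary_hM:
  fixes h :: "'a::polish_space \<Rightarrow> real"
  assumes kap: "cord_le (OSucc OZero) kap" and h: "h \<in> Mult kap kap"
  shows "(\<Inter>M \<in> {M::real. M > 0}. deriv_iter (hM h M) (cord_wexp kap) UNIV) = {}"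
proof (rule ccontr)
  let ?a = "cord_wexp kap"
  assume "\<not> ?thesis"
  then obtain x where x: "\<And>M. M > 0 \<Longrightarrow> x \<in> deriv_iter (hM h M) ?a UNIV"
    by auto
  obtain s where s: "cord_eq ?a (OLim (\<lambda>n. OSucc (s n)))"
    using cord_sup_representation[of ?a] cord_le_trans[OF one_le_cord_wexp] Suc_not_cord_le_zero by blast
  have M: "real (Suc j) > 0" for j by simp
  obtain y Sj U S f where b: "bouquet x y Sj U S"
    and f0: "\<forall>p. p \<notin> (\<Union>j. Sj j) \<longrightarrow> f p = 0"
    and f: "\<forall>j. \<forall>p\<in>Sj j. 0 \<le> f p \<and> f p \<le> 1 / real (Suc j)"
    and ac: "\<forall>j. deriv_iter acc ?a (Sj j) = {}"
    and g: "\<forall>g. (\<forall>p\<in>S - {x}. g p = h p * f p) \<longrightarrow> x \<in> deriv_iter (osc_der g 1) ?a S"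
    by (rule hM_tree_step[where M = "\<lambda>j. real (Suc j)", OF zero_less_one M hM_iterate_limpt[OF s x[OF M]] hM_tree_exists[OF M] s])
  note bD = bouquetD[OF b]
  have "deriv_iter (osc_der f e) ?a UNIV = {}" if e: "e > 0" for e
  proof -
    obtain N :: nat where N: "1 / real (Suc N) < e"
      using reals_Archimedean[OF e] by (auto simp: inverse_eq_divide)
    define T where "T = (\<Union>j\<in>{..<N}. Sj j)"
    have T: "closed T"
      unfolding T_def using bD(7) by (intro closed_UN) auto
    have small: "0 \<le> f p \<and> f p < e" if "p \<notin> T" for p
    proof (cases "\<exists>j. p \<in> Sj j")
      case True
      then obtain j where j: "p \<in> Sj j" by blast
      with that have "N \<le> j" by (auto simp: T_def not_less)
      then have "1 / real (Suc j) \<le> 1 / real (Suc N)" by (simp add: frac_le)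
      then show ?thesis using f[rule_format, OF j] N by linarith
    next
      case False
      then show ?thesis using f0 e by simp
    qed
    have sub: "osc_der f e UNIV \<subseteq> T"
    proof
      fix p assume p: "p \<in> osc_der f e UNIV"
      show "p \<in> T"
      proof (rule ccontr)
        assume "p \<notin> T"
        then obtain x1 x2 where "x1 \<notin> T" "x2 \<notin> T" "\<bar>f x1 - f x2\<bar> \<ge> e"
          using in_osc_derE[OF p, of "- T"] T by (metis Compl_iff open_Compl)
        then show False
          using small[of x1] small[of x2] by linarith
      qed
    qed
    \<comment> \<open>Since 1 + omega^kap = omega^kap, the derivative that confines everything to
      \<open>T\<close> costs nothing.\<close>
    have "deriv_iter (osc_der f e) ?a UNIV \<subseteq> deriv_iter (osc_der f e) (cord_add (OSucc OZero) ?a) UNIV"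
      by (rule deriv_iter_antimono[OF derivation_osc_der closed_UNIV one_plus_cord_wexp[OF kap]])
    also have "\<dots> = deriv_iter (osc_der f e) ?a (osc_der f e UNIV)"
      by (simp add: deriv_iter_add)
    also have "\<dots> \<subseteq> deriv_iter acc ?a T"
      by (rule deriv_iter_le[OF derivation_osc_der derivation_acc
            derivation_closed[OF derivation_osc_der closed_UNIV] T sub osc_der_subset_acc[OF e]])
    also have "\<dots> \<subseteq> (\<Union>j\<in>{..<N}. deriv_iter acc ?a (Sj j))"
      unfolding T_def
      by (rule additive_Union[OF derivation_iter[OF derivation_acc] additive_iter[OF derivation_acc additive_acc]])
        (simp_all add: bD(7))
    also have "\<dots> = {}" using ac by simp
    finally show ?thesis by blast
  qed
  then have "(\<lambda>p. h p * f p) \<in> B1 kap"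
    using h unfolding Mult_def by (simp add: B1_iff)
  then have "deriv_iter (osc_der (\<lambda>p. h p * f p) 1) ?a UNIV = {}"
    by (simp add: B1_iff)
  moreover have "x \<in> deriv_iter (osc_der (\<lambda>p. h p * f p) 1) ?a S"
    using g by simp
  ultimately show False
    using deriv_iter_mono[OF derivation_osc_der bD(1) closed_UNIV subset_UNIV] by blast
qed

subsection \<open>The oscillation of a multiplier\<close>

text \<open>The ratio \<open>G\<close> between the two counts is the point: with b = omega^al it
  turns omega^al derivatives of the factor into omega^kap derivatives of the product.\<close>

definition Omega_tree :: "('a::metric_space \<Rightarrow> real) \<Rightarrow> cord \<Rightarrow> cord \<Rightarrow> 'a \<Rightarrow> 'a set \<Rightarrow> ('a \<Rightarrow> real) \<Rightarrow> bool" where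
  "Omega_tree h G b x S f \<longleftrightarrow> (\<forall>f'. (\<forall>p\<in>S - {x}. f' p = f p) \<longrightarrow>
     (\<forall>e>0. deriv_iter (osc_der f' e) b S \<subseteq> {x}) \<and>
     x \<in> deriv_iter (deriv_iter (osc_der (\<lambda>p. h p * f' p) 1) G) b S)"

text \<open>An intermediate tree: after the first b stages f' is constant on what remains, so one
  more derivative ends it however large c is, while the product lasts for c more. The root belongs
  to this constant part, hence its value is fixed to v.\<close>

definition delta_tree ::
  "('a::metric_space \<Rightarrow> real) \<Rightarrow> cord \<Rightarrow> cord \<Rightarrow> cord \<Rightarrow> real \<Rightarrow> 'a \<Rightarrow> 'a set \<Rightarrow> ('a \<Rightarrow> real) \<Rightarrow> bool" where
  "delta_tree h G b c v x S f \<longleftrightarrow> (\<forall>f'. (\<forall>p\<in>S. f' p = f p) \<longrightarrow> f' x = v \<and>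
     (\<forall>e>0. deriv_iter (osc_der f' e) b S \<subseteq> {p. f' p = v}) \<and>
     x \<in> deriv_iter (osc_der (\<lambda>p. h p * f' p) 1) c
           (deriv_iter (deriv_iter (osc_der (\<lambda>p. h p * f' p) 1) G) b S))"

lemma delta_treeD:
  assumes "delta_tree h G b c v x S f" "\<forall>p\<in>S. f' p = f p"
  shows "f' x = v" "e > 0 \<Longrightarrow> deriv_iter (osc_der f' e) b S \<subseteq> {p. f' p = v}"
    "x \<in> deriv_iter (osc_der (\<lambda>p. h p * f' p) 1) c
       (deriv_iter (deriv_iter (osc_der (\<lambda>p. h p * f' p) 1) G) b S)"
  using assms(1)[unfolded delta_tree_def, THEN spec, THEN mp, OF assms(2)] by blast+

text \<open>On a tree witnessing the iterated oscillation of \<open>h\<close> by \<open>\<eta>\<close> along a set, \<open>f\<close> is the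
constant \<open>2/\<eta>\<close>. Hence \<open>f\<close> needs one derivative where the product needs \<open>c\<close> of them.\<close>

lemma delta_tree_exists:
  fixes h :: "'a::metric_space \<Rightarrow> real"
  assumes W: "closed W" and eta: "eta > 0"
    and tree: "\<And>x r. x \<in> W \<Longrightarrow> r > 0 \<Longrightarrow> \<exists>S f. closed S \<and> x \<in> S \<and> S \<subseteq> ball x r \<and> Omega_tree h G b x S f"
    and "x \<in> deriv_iter (osc_der h eta) c W" "r > 0"
  shows "\<exists>S f. closed S \<and> x \<in> S \<and> S \<subseteq> ball x r \<and> delta_tree h G b c (2 / eta) x S f"
  using assms(4,5)
proof (induction c arbitrary: x r rule: cord_sup_induct)
  case (zero c)
  then have "x \<in> W"
    using deriv_iter_subset[OF derivation_osc_der W] by blast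
  from tree[OF this zero(3)] obtain S f where S: "closed S" "x \<in> S" "S \<subseteq> ball x r"
    and t: "Omega_tree h G b x S f"
    by (elim exE conjE)
  \<comment> \<open>A leaf of the tree along c is itself an \<open>Omega_tree\<close>, whose free
    root value is set to the common constant.\<close>
  have "delta_tree h G b c (2 / eta) x S (f(x := 2 / eta))"
    unfolding delta_tree_def
  proof (intro allI impI)
    fix f' assume f': "\<forall>p\<in>S. f' p = (f(x := 2 / eta)) p"
    then have fx: "f' x = 2 / eta" and "\<forall>p\<in>S - {x}. f' p = f p"
      using S(2) by auto
    with t have 1: "\<forall>e>0. deriv_iter (osc_der f' e) b S \<subseteq> {x}"
      and 2: "x \<in> deriv_iter (deriv_iter (osc_der (\<lambda>p. h p * f' p) 1) G) b S"
      unfolding Omega_tree_def by simp_all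
    have "closed (deriv_iter (deriv_iter (osc_der (\<lambda>p. h p * f' p) 1) G) b S)"
      by (rule deriv_iter_closed[OF derivation_iter[OF derivation_osc_der] S(1)])
    with 2 have "x \<in> deriv_iter (osc_der (\<lambda>p. h p * f' p) 1) c
        (deriv_iter (deriv_iter (osc_der (\<lambda>p. h p * f' p) 1) G) b S)"
      by (simp add: deriv_iter_zero[OF derivation_osc_der _ zero(1)])
    moreover have "deriv_iter (osc_der f' e) b S \<subseteq> {p. f' p = 2 / eta}" if "e > 0" for e
      using 1 that fx by blast
    ultimately show "f' x = 2 / eta \<and> (\<forall>e>0. deriv_iter (osc_der f' e) b S \<subseteq> {p. f' p = 2 / eta}) \<and>
        x \<in> deriv_iter (osc_der (\<lambda>p. h p * f' p) 1) c
          (deriv_iter (deriv_iter (osc_der (\<lambda>p. h p * f' p) 1) G) b S)"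
      using fx by simp
  qed
  then show ?case
    using S by (intro exI[of _ S] exI[of _ "f(x := 2 / eta)"] conjI)
next
  case (sup c s)
  define idx where "idx = (\<lambda>j. s (fst (prod_decode j)))"
  \<comment> \<open>Two values of h at least \<open>eta\<close> apart near x give one at least eta/2
    away from h x; the constant 2/eta turns this into a jump of the product of at least 1.\<close>
  define A where "A = (\<lambda>j. deriv_iter (osc_der h eta) (idx j) W \<inter> {z. \<bar>h z - h x\<bar> \<ge> eta / 2})"
  have lim: "x islimpt A j" for j
  proof (rule islimptI)
    fix T assume T: "x \<in> T" "open T"
    have "x \<in> osc_der h eta (deriv_iter (osc_der h eta) (idx j) W)"
      using sup(3) unfolding deriv_iter_sup[OF derivation_osc_der W sup(1)] idx_def by simp
    then have "x \<in> O_set h (eta / 2) (deriv_iter (osc_der h eta) (idx j) W)"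
      by (rule subsetD[OF osc_der_subset_O_set])
    then obtain y where "y \<in> deriv_iter (osc_der h eta) (idx j) W" "y \<in> T" "\<bar>h y - h x\<bar> \<ge> eta / 2"
      using T(2,1) by (rule in_O_setE)
    then show "\<exists>y\<in>A j. y \<in> T \<and> y \<noteq> x"
      using eta by (intro bexI[of _ y]) (auto simp: A_def)
  qed
  have ex: "\<exists>S f. closed S \<and> y \<in> S \<and> S \<subseteq> ball y \<rho> \<and> delta_tree h G b (idx j) (2 / eta) y S f"
    if y: "y \<in> A j" and \<rho>: "\<rho> > 0" for j y \<rho>
    unfolding idx_def by (rule sup(2)[OF _ \<rho>]) (use y in \<open>simp add: A_def idx_def\<close>)
  obtain y Sj fj U S f where bq: "bouquet x y Sj U S" and S: "S \<subseteq> ball x r"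
    and f0: "\<forall>p. p \<notin> (\<Union>j. Sj j) \<longrightarrow> f p = 0" and fj: "\<forall>j. \<forall>p\<in>Sj j. f p = fj j p"
    and yA: "\<forall>j. y j \<in> A j" and t: "\<forall>j. delta_tree h G b (idx j) (2 / eta) (y j) (Sj j) (fj j)"
    by (rule bouquet_exists[where A = A and Pr = "\<lambda>j. delta_tree h G b (idx j) (2 / eta)",
          OF sup(4) lim ex])
  note bD = bouquetD[OF bq]
  have "delta_tree h G b c (2 / eta) x S (f(x := 2 / eta))"
    unfolding delta_tree_def
  proof (intro allI impI)
    fix f' assume f': "\<forall>p\<in>S. f' p = (f(x := 2 / eta)) p"
    then have fx: "f' x = 2 / eta" using bD(2) by simp
    have "f' p = fj j p" if "p \<in> Sj j" for p j
      using f' fj that bD(6)[of j] bD(10)[of j] by auto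
    then have fS: "\<forall>p\<in>Sj j. f' p = fj j p" for j by simp
    let ?d = "osc_der (\<lambda>p. h p * f' p) 1"
    let ?E = "deriv_iter (deriv_iter ?d G) b"
    have E: "derivation ?E"
      by (intro derivation_iter derivation_osc_der)
    note fy = delta_treeD(1)[OF t[rule_format] fS] and osc = delta_treeD(2)[OF t[rule_format] fS]
      and yj = delta_treeD(3)[OF t[rule_format] fS]
    have "deriv_iter (osc_der f' e) b S \<subseteq> {p. f' p = 2 / eta}" if "e > 0" for e
      using bouquet_deriv_iter[OF bq derivation_osc_der osc_der_local, of f' e b] osc[OF that] fx by blast
    moreover have "x \<in> ?d (deriv_iter ?d (s i) (?E S))" for i
    proof -
      let ?R = "deriv_iter ?d (s i) (?E S)"
      have yR: "y j \<in> deriv_iter ?d (idx j) (?E S)" for j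
        using yj[of j] deriv_iter_mono[OF derivation_osc_der derivation_closed[OF E bD(7)]
            derivation_closed[OF E bD(1)] derivation_mono[OF E bD(7,1,10)]]
        by (rule rev_subsetD)
      have zR: "y (prod_encode (i, k)) \<in> ?R" for k
        using yR[of "prod_encode (i, k)"] by (simp add: idx_def)
      have cl: "closed ?R"
        by (rule deriv_iter_closed[OF derivation_osc_der derivation_closed[OF E bD(1)]])
      have xR: "x \<in> ?R"
        using bD(4) cl zR by (rule closed_prod_encode)
      then show ?thesis
      proof (rule in_osc_derI)
        fix V assume "open V" "x \<in> V"
        then obtain k where k: "y (prod_encode (i, k)) \<in> V"
          using topological_tendstoD[OF tendsto_prod_encode[OF bD(4)] \<open>open V\<close> \<open>x \<in> V\<close>]
          unfolding eventually_sequentially by auto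
        let ?z = "y (prod_encode (i, k))"
        have "h ?z * f' ?z - h x * f' x = (h ?z - h x) * (2 / eta)"
          by (simp only: fy fx left_diff_distrib)
        then have "\<bar>h ?z * f' ?z - h x * f' x\<bar> = \<bar>h ?z - h x\<bar> * (2 / eta)"
          using eta by (simp only: abs_mult) simp
        moreover have "\<bar>h ?z - h x\<bar> \<ge> eta / 2"
          using yA by (auto simp: A_def)
        then have "\<bar>h ?z - h x\<bar> * (2 / eta) \<ge> 1"
          using eta by (simp add: field_simps)
        ultimately have "\<bar>h ?z * f' ?z - h x * f' x\<bar> \<ge> 1"
          by simp
        then show "\<exists>x1\<in>?R \<inter> V. \<exists>x2\<in>?R \<inter> V. 1 \<le> \<bar>h x1 * f' x1 - h x2 * f' x2\<bar>"
          using k zR xR \<open>x \<in> V\<close> by (intro bexI[of _ ?z] bexI[of _ x]) auto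
      qed
    qed
    then have "x \<in> deriv_iter ?d c (?E S)"
      unfolding deriv_iter_sup[OF derivation_osc_der derivation_closed[OF E bD(1)] sup(1)] by simp
    ultimately show "f' x = 2 / eta \<and> (\<forall>e>0. deriv_iter (osc_der f' e) b S \<subseteq> {p. f' p = 2 / eta}) \<and>
        x \<in> deriv_iter ?d c (?E S)"
      using fx by simp
  qed
  then show ?case
    using bD(1,2) S by (intro exI[of _ S] exI[of _ "f(x := 2 / eta)"] conjI)
qed

text \<open>For each pair (i, n) infinitely many children survive \<open>xis n\<close> derivatives
  of the product beyond stage \<open>s i\<close>. Their limit x then survives too, by closedness
  alone, and as n varies it survives \<open>G\<close> derivatives. The threshold changes from child
  to child, so f may be unbounded near x; this adds only the single point x to what f leaves after b
  derivatives.\<close>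

lemma Omega_tree_exists:
  fixes h :: "'a::metric_space \<Rightarrow> real"
  assumes lim: "cord_eq (OLim xis) G"
    and "x \<in> deriv_iter (Omega h xis) b UNIV" "r > 0"
  shows "\<exists>S f. closed S \<and> x \<in> S \<and> S \<subseteq> ball x r \<and> Omega_tree h G b x S f"
  using assms(2,3)
proof (induction b arbitrary: x r rule: cord_sup_induct)
  case (zero b)
  have "Omega_tree h G b x {x} (\<lambda>_. 0)"
    unfolding Omega_tree_def
    using deriv_iter_zero[OF derivation_osc_der _ zero(1), of "{x}"]
      deriv_iter_zero[OF derivation_iter[OF derivation_osc_der] _ zero(1), of "{x}"] by simp
  then show ?case
    using zero(3) by (intro exI[of _ "{x}"] exI[of _ "\<lambda>_. 0"]) simp
next
  case (sup b s)
  \<comment> \<open>The index j codes ((i, n), k): i is the stage of the \<open>Omega\<close>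
    iteration, n the term of \<open>xis\<close>, and k repeats each pair infinitely often.\<close>
  define idx where "idx = (\<lambda>j. fst (prod_decode (fst (prod_decode j))))"
  define xn where "xn = (\<lambda>j. xis (snd (prod_decode (fst (prod_decode j)))))"
  define W where "W = (\<lambda>j. deriv_iter (Omega h xis) (s (idx j)) UNIV)"
  define A where "A = (\<lambda>j. \<Union>eta\<in>{eta. eta > 0}. deriv_iter (delta h eta) (xn j) (W j))"
  have W: "closed (W j)" for j
    unfolding W_def by (rule deriv_iter_closed[OF derivation_Omega closed_UNIV])
  have limA: "x islimpt A j" for j
  proof -
    have "x \<in> Omega h xis (W j)"
      using sup(3) unfolding deriv_iter_sup[OF derivation_Omega closed_UNIV sup(1)] W_def by simp
    then show ?thesis
      unfolding Omega_def acc_def A_def xn_def by simp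
  qed
  define Pr where "Pr = (\<lambda>j y S f. \<exists>v. delta_tree h G (s (idx j)) (xn j) v y S f)"
  have ex: "\<exists>S f. closed S \<and> y \<in> S \<and> S \<subseteq> ball y \<rho> \<and> Pr j y S f"
    if y: "y \<in> A j" and \<rho>: "\<rho> > 0" for j y \<rho>
  proof -
    obtain eta where eta: "eta > 0" "y \<in> deriv_iter (delta h eta) (xn j) (W j)"
      using y unfolding A_def by auto
    have "deriv_iter (delta h eta) (xn j) (W j) \<subseteq> deriv_iter (osc_der h eta) (xn j) (W j)"
      by (rule deriv_iter_le[OF derivation_delta derivation_osc_der W W order_refl delta_subset_osc_der])
    with eta(2) have y': "y \<in> deriv_iter (osc_der h eta) (xn j) (W j)" by blast
    have "\<exists>S f. closed S \<and> y \<in> S \<and> S \<subseteq> ball y \<rho> \<and> delta_tree h G (s (idx j)) (xn j) (2 / eta) y S f"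
    proof (rule delta_tree_exists[OF W eta(1) _ y' \<rho>])
      show "\<exists>S f. closed S \<and> z \<in> S \<and> S \<subseteq> ball z t \<and> Omega_tree h G (s (idx j)) z S f"
        if "z \<in> W j" "t > 0" for z t
        by (rule sup(2)[OF _ that(2)]) (use that(1) in \<open>simp add: W_def\<close>)
    qed
    then show ?thesis
      unfolding Pr_def by blast
  qed
  obtain y Sj fj U S f where bq: "bouquet x y Sj U S" and S: "S \<subseteq> ball x r"
    and f0: "\<forall>p. p \<notin> (\<Union>j. Sj j) \<longrightarrow> f p = 0" and fj: "\<forall>j. \<forall>p\<in>Sj j. f p = fj j p"
    and yA: "\<forall>j. y j \<in> A j" and t: "\<forall>j. Pr j (y j) (Sj j) (fj j)"
    by (rule bouquet_exists[where A = A and Pr = Pr, OF sup(4) limA ex])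
  note bD = bouquetD[OF bq]
  have "Omega_tree h G b x S f"
    unfolding Omega_tree_def
  proof (intro allI impI)
    fix f' assume f': "\<forall>p\<in>S - {x}. f' p = f p"
    have "f' p = fj j p" if "p \<in> Sj j" for p j
    proof -
      have "p \<in> S - {x}"
        using that bD(6)[of j] bD(10)[of j] by blast
      then show ?thesis using f' fj that by simp
    qed
    then have fS: "\<forall>p\<in>Sj j. f' p = fj j p" for j by simp
    let ?d = "osc_der (\<lambda>p. h p * f' p) 1"
    let ?E = "deriv_iter (deriv_iter ?d G)"
    have E: "derivation (?E c)" for c
      by (intro derivation_iter derivation_osc_der)
    have osc: "deriv_iter (osc_der f' e) b (Sj j) = {}" if "e > 0" for e j
    proof -
      obtain v where "delta_tree h G (s (idx j)) (xn j) v (y j) (Sj j) (fj j)"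
        using t unfolding Pr_def by blast
      then have "deriv_iter (osc_der f' e) (s (idx j)) (Sj j) \<subseteq> {p. f' p = v}"
        using fS that by (rule delta_treeD(2))
      \<comment> \<open>f' is the constant v on what is left at stage \<open>s (idx j)\<close>, so
        the next derivative, still within b, is empty.\<close>
      then have "osc_der f' e (deriv_iter (osc_der f' e) (s (idx j)) (Sj j)) = {}"
        using that by (intro osc_der_const_empty[where v = v]) auto
      then show ?thesis
        unfolding deriv_iter_sup[OF derivation_osc_der bD(7) sup(1)] by blast
    qed
    have yj: "y j \<in> deriv_iter ?d (xn j) (?E (s (idx j)) (Sj j))" for j
    proof -
      obtain v where "delta_tree h G (s (idx j)) (xn j) v (y j) (Sj j) (fj j)"
        using t unfolding Pr_def by blast
      then show ?thesis using fS by (rule delta_treeD(3))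
    qed
    have "deriv_iter (osc_der f' e) b S \<subseteq> {x}" if "e > 0" for e
      using bouquet_deriv_iter[OF bq derivation_osc_der osc_der_local, of f' e b] osc[OF that] by simp
    moreover have "x \<in> deriv_iter ?d G (?E (s i) S)" for i
    proof -
      have "x \<in> deriv_iter ?d (xis n) (?E (s i) S)" for n
      proof -
        have yR: "y j \<in> deriv_iter ?d (xn j) (?E (s (idx j)) S)" for j
          using yj[of j] deriv_iter_mono[OF derivation_osc_der derivation_closed[OF E bD(7)]
              derivation_closed[OF E bD(1)] derivation_mono[OF E bD(7,1,10)]]
          by (rule rev_subsetD)
        have "y (prod_encode (prod_encode (i, n), k)) \<in> deriv_iter ?d (xis n) (?E (s i) S)" for k
          using yR[of "prod_encode (prod_encode (i, n), k)"] by (simp add: idx_def xn_def)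
        then show ?thesis
          by (rule closed_prod_encode[OF bD(4)
                deriv_iter_closed[OF derivation_osc_der derivation_closed[OF E bD(1)]]])
      qed
      then show ?thesis
        unfolding deriv_iter_eq[OF derivation_osc_der derivation_closed[OF E bD(1)] lim, symmetric]
        by simp
    qed
    then have "x \<in> ?E b S"
      unfolding deriv_iter_sup[OF derivation_iter[OF derivation_osc_der] bD(1) sup(1)] by simp
    ultimately show "(\<forall>e>0. deriv_iter (osc_der f' e) b S \<subseteq> {x}) \<and> x \<in> ?E b S"
      by simp
  qed
  then show ?case
    using bD(1,2) S by (intro exI[of _ S] exI[of _ f]) simp
qed

lemma multiplier_necessary_Omega:
  fixes h :: "'a::polish_space \<Rightarrow> real"
  assumes kap: "cord_le (OSucc OZero) kap" and al: "cord_le (OSucc al) kap"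
    and cnf: "cord_eq kap (cord_add (cord_wexp xi) al)"
    and lim: "cord_eq (OLim xis) (cord_wexp (cord_wexp xi))"
    and h: "h \<in> Mult kap kap"
  shows "deriv_iter (Omega h xis) (cord_wexp al) UNIV = {}"
proof (rule ccontr)
  let ?k = "cord_wexp kap" and ?a = "cord_wexp al" and ?G = "cord_wexp (cord_wexp xi)"
  assume "\<not> ?thesis"
  then obtain x where "x \<in> deriv_iter (Omega h xis) ?a UNIV"
    by blast
  from Omega_tree_exists[OF lim this zero_less_one] obtain S f0 where S: "closed S" "x \<in> S"
    and t: "Omega_tree h ?G ?a x S f0"
    by (elim exE conjE)
  define f where "f = (\<lambda>p. if p \<in> S then f0 p else 0)"
  have "\<forall>p\<in>S - {x}. f p = f0 p" by (simp add: f_def)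
  with t have osc: "\<forall>e>0. deriv_iter (osc_der f e) ?a S \<subseteq> {x}"
    and x: "x \<in> deriv_iter (deriv_iter (osc_der (\<lambda>p. h p * f p) 1) ?G) ?a S"
    unfolding Omega_tree_def by simp_all
  have "deriv_iter (osc_der f e) ?k UNIV = {}" if e: "e > 0" for e
  proof -
    let ?d = "osc_der f e"
    have sub: "?d UNIV \<subseteq> S"
    proof
      fix p assume p: "p \<in> ?d UNIV"
      show "p \<in> S"
      proof (rule ccontr)
        assume "p \<notin> S"
        then obtain x1 x2 where "x1 \<notin> S" "x2 \<notin> S" "\<bar>f x1 - f x2\<bar> \<ge> e"
          using in_osc_derE[OF p, of "- S"] S(1) by (metis Compl_iff open_Compl)
        then show False using e by (simp add: f_def)
      qed
    qed
    have "deriv_iter ?d ?a (?d UNIV) \<subseteq> {x}"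
      using deriv_iter_mono[OF derivation_osc_der derivation_closed[OF derivation_osc_der closed_UNIV] S(1) sub]
        osc e by blast
    then have "?d (deriv_iter ?d ?a (?d UNIV)) = {}"
      by (intro osc_der_const_empty[OF e, where v = "f x"]) auto
    then have "deriv_iter ?d (OSucc (cord_add (OSucc OZero) ?a)) UNIV = {}"
      by (simp add: deriv_iter_add)
    \<comment> \<open>One derivative to enter S, omega^al to reach {x}, and one to remove x: because
      al < kap, the total is at most omega^kap.\<close>
    moreover have "cord_le (OSucc (cord_add (OSucc OZero) ?a)) ?k"
      by (intro cord_add_less_wexp one_less_cord_wexp cord_wexp_less kap al)
    ultimately show ?thesis
      using deriv_iter_antimono[OF derivation_osc_der closed_UNIV] by blast
  qed
  then have "(\<lambda>p. h p * f p) \<in> B1 kap"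
    using h unfolding Mult_def by (simp add: B1_iff)
  then have "deriv_iter (osc_der (\<lambda>p. h p * f p) 1) ?k UNIV = {}"
    by (simp add: B1_iff)
  then have "deriv_iter (deriv_iter (osc_der (\<lambda>p. h p * f p) 1) ?G) ?a UNIV = {}"
    using deriv_iter_cnf[OF derivation_osc_der cnf] by blast
  then show False
    using x deriv_iter_mono[OF derivation_iter[OF derivation_osc_der] S(1) closed_UNIV subset_UNIV] by blast
qed

theorem theorem4p18:
  fixes h :: "'a::polish_space \<Rightarrow> real"
    and kap xi al :: cord
    and xis :: "nat \<Rightarrow> cord"
  assumes "cord_less OZero kap"
    and "cnf_split kap xi al"
    and "\<And>n. cord_less (xis n) (xis (Suc n))"
    and "cord_eq (OLim xis) (cord_wexp (cord_wexp xi))"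
  shows "h \<in> Mult kap kap \<longleftrightarrow>
    ((\<Inter>M \<in> {M::real. M > 0}. deriv_iter (hM h M) (cord_wexp kap) UNIV) = {} \<and>
     deriv_iter (Omega h xis) (cord_wexp al) UNIV = {})"
proof
  have kap: "cord_le (OSucc OZero) kap" and cnf: "cord_eq kap (cord_add (cord_wexp xi) al)"
    using assms(1,2) by (auto simp: cord_less_def cnf_split_def)
  show "(\<Inter>M \<in> {M::real. M > 0}. deriv_iter (hM h M) (cord_wexp kap) UNIV) = {} \<and>
      deriv_iter (Omega h xis) (cord_wexp al) UNIV = {}" if h: "h \<in> Mult kap kap"
    using multiplier_necessary_hM[OF kap h]
      multiplier_necessary_Omega[OF kap cnf_split_less[OF assms(2)] cnf assms(4) h] by (rule conjI)
  show "h \<in> Mult kap kap"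
    if c: "(\<Inter>M \<in> {M::real. M > 0}. deriv_iter (hM h M) (cord_wexp kap) UNIV) = {} \<and>
      deriv_iter (Omega h xis) (cord_wexp al) UNIV = {}"
    unfolding Mult_def
    using multiplier_sufficient[OF cnf assms(3,4) conjunct1[OF c] conjunct2[OF c]] by simp
qed

end
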